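(* Let $n\in\mathbb N$. Let $M=(M_k)_{k=0}^\infty$ be a sequence of positive numbers with $M_0=1$ and $\lim_{k\to\infty}\frac{\ln M_k}{k}=+\infty$, satisfying: $\alpha_1)$ $M_k^2\le M_{k-1}M_{k+1}$ for all $k\in\mathbb N$; $\alpha_2)$ for every $\varepsilon>0$ there is $a_\varepsilon>0$ such that $M_k\le a_\varepsilon\,\varepsilon^k\,k!$ for all $k\in\mathbb Z_+$; $\alpha_3)$ $K=(K_m)_{m=0}^\infty$ is a logarithmically convex sequence of positive numbers with $K_0=1$, and $t_1>1$, $t_2>1$ are numbers such that $$t_1^{-1}t_2^{-m}K_m\le\frac{m!}{M_m}\le t_1t_2^mK_m\quad\text{for all } m\in\mathbb Z_+.$$ Let $\varPhi=\{\varphi_m\}_{m=1}^\infty$ be a family of real-valued continuous functions on $\mathbb R^n$ such that for each $m\in\mathbb N$: 1) $\lim_{x\to\infty}\frac{\varphi_m(x)}{\|x\|}=+\infty$; 2) $\lim_{x\to\infty}(\varphi_m(x)-\varphi_{m+1}(x))=+\infty$; 3) there is a constant $a_m>1$ (depending only on $m$) such that for each $\delta>0$ there is a constant $b_{m,\delta}>0$ such that for every $R>0$, every $x\in\mathbb R^n$ and every $\xi\in\mathbb R^n$ with $\|\xi\|\le R$, $$\varphi_{m+1}(x+\xi)\le\varphi_m(x)+w_K(a_m\delta R)+b_{m,\delta}.$$ Then the locally convex spaces $G(M,\varPhi)$ and $E(K,\varPhi)$ are isomorphic (as topological vector spaces).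
   Context: $\mathbb Z_+=\{0,1,2,\dots\}$, and $\|\cdot\|$ is the Euclidean norm on $\mathbb R^n$. For $\alpha\in\mathbb Z_+^n$, $|\alpha|=\alpha_1+\dots+\alpha_n$ and $D^\alpha$ is the corresponding partial derivative. For $z\in\mathbb C^n$ write $z=x+iy$ with $x=\operatorname{Re}z$, $y=\operatorname{Im}z\in\mathbb R^n$. A sequence $(K_m)_{m=0}^\infty$ of positive numbers is logarithmically convex if $K_m^2\le K_{m-1}K_{m+1}$ for all $m\in\mathbb N$. The function $w_K$ on $[0,\infty)$ is defined by $w_K(r)=\sup_{m\in\mathbb Z_+}\ln\frac{r^m}{K_m}$ for $r>0$, and $w_K(0)=0$. The space $G(M,\varPhi)$: for $m\in\mathbb N$ and $\varepsilon>0$ let $G_{m,\varepsilon}$ be the space of complex-valued $C^\infty$ functions $f$ on $\mathbb R^n$ with finite norm $$p_{m,\varepsilon}(f)=\sup_{x\in\mathbb R^n,\ \alpha\in\mathbb Z_+^n}\frac{|(D^\alpha f)(x)|}{\varepsilon^{|\alpha|}M_{|\alpha|}e^{\varphi_m(x)}}.$$ Put $G(M,\varPhi)=\bigcap_{m=1}^\infty\bigcap_{\varepsilon>0}G_{m,\varepsilon}$, a complex vector space with the usual operations, endowed with the locally convex topology defined by the family of norms $p_{m,\varepsilon}$ ($m\in\mathbb N$, $\varepsilon>0$). The space $E(K,\varPhi)$: the complex vector space of entire functions $f$ on $\mathbb C^n$ such that for each $m\in\mathbb N$ and each $\varepsilon>0$ there is a constant $c_{m,\varepsilon}>0$ with $|f(z)|\le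 c_{m,\varepsilon}e^{\varphi_m(x)+w_K(\varepsilon\|y\|)}$ for all $z=x+iy\in\mathbb C^n$, endowed with the locally convex topology defined by the family of norms $$q_{m,\varepsilon}(f)=\sup_{z\in\mathbb C^n}\frac{|f(z)|}{e^{\varphi_m(x)+w_K(\varepsilon\|y\|)}},\quad m\in\mathbb N,\ \varepsilon>0.$$ *)

theory Defs
  imports "HOL-Analysis.Analysis"
begin

section \<open>Smooth functions and partial derivatives on \<open>\<real>\<^sup>n\<close>\<close>

definition partial_deriv :: "'n::finite \<Rightarrow> (real^'n \<Rightarrow> complex) \<Rightarrow> real^'n \<Rightarrow> complex" where
  "partial_deriv i f x = vector_derivative (\<lambda>t::real. f (x + t *\<^sub>R axis i 1)) (at 0)"

primrec iter_partial :: "'n::finite list \<Rightarrow> (real^'n \<Rightarrow> complex) \<Rightarrow> real^'n \<Rightarrow> complex" where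
  "iter_partial [] f = f"
| "iter_partial (i # is) f = partial_deriv i (iter_partial is f)"

text \<open>All partial derivatives of all orders exist everywhere and are continuous.\<close>

definition smooth :: "(real^'n::finite \<Rightarrow> complex) \<Rightarrow> bool" where
  "smooth f \<longleftrightarrow>
     (\<forall>is. continuous_on UNIV (iter_partial is f) \<and>
       (\<forall>i x. (\<lambda>t::real. iter_partial is f (x + t *\<^sub>R axis i 1)) differentiable (at 0)))"

definition mi_order :: "('n::finite \<Rightarrow> nat) \<Rightarrow> nat" where
  "mi_order \<alpha> = (\<Sum>i\<in>UNIV. \<alpha> i)"

text \<open>The index type carries no order, so the sequence in which the \<open>\<alpha> i\<close> differentiations in
  direction \<open>i\<close> are carried out is chosen arbitrarily. For smooth functions it is irrelevant,
  by the symmetry of mixed partial derivatives.\<close>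

definition mi_deriv :: "('n::finite \<Rightarrow> nat) \<Rightarrow> (real^'n \<Rightarrow> complex) \<Rightarrow> real^'n \<Rightarrow> complex" where
  "mi_deriv \<alpha> f = iter_partial (SOME is. \<forall>i. count_list is i = \<alpha> i) f"

section \<open>Entire functions on \<open>\<complex>\<^sup>n\<close>\<close>

definition Re_vec :: "complex^'n::finite \<Rightarrow> real^'n" where
  "Re_vec z = (\<chi> i. Re (z $ i))"

definition Im_vec :: "complex^'n::finite \<Rightarrow> real^'n" where
  "Im_vec z = (\<chi> i. Im (z $ i))"

text \<open>Complex differentiability at every point: the Frechet derivative exists and is
  complex-linear.\<close>

definition entire :: "(complex^'n::finite \<Rightarrow> complex) \<Rightarrow> bool" where
  "entire f \<longleftrightarrow> (\<forall>z. \<exists>f'. (f has_derivative f') (at z) \<and> (\<forall>c v. f' (c *s v) = c * f' v))"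

section \<open>Locally convex topologies on spaces of complex-valued functions\<close>

text \<open>The topology on \<open>V\<close> having the balls of the (semi)norms in \<open>P\<close> as a subbase.\<close>

definition seminorm_topology ::
    "('a \<Rightarrow> complex) set \<Rightarrow> (('a \<Rightarrow> complex) \<Rightarrow> ereal) set \<Rightarrow> ('a \<Rightarrow> complex) topology" where
  "seminorm_topology V P = topology_generated_by
     {{g \<in> V. p (\<lambda>x. g x - f x) < ereal r} | p f r. p \<in> P \<and> f \<in> V \<and> 0 < r}"

lemma topspace_seminorm_topology:
  assumes "P \<noteq> {}" and "\<And>p. p \<in> P \<Longrightarrow> p (\<lambda>x. 0) = 0"
  shows "topspace (seminorm_topology V P) = V"
proof -
  obtain p where p: "p \<in> P" using assms(1) by blast
  have "f \<in> topspace (seminorm_topology V P)" if "f \<in> V" for f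
  proof -
    have "f \<in> {g \<in> V. p (\<lambda>x. g x - f x) < ereal 1}"
      using that assms(2)[OF p] by simp
    then show ?thesis
      unfolding seminorm_topology_def topology_generated_by_topspace
      using p that zero_less_one by blast
  qed
  then show ?thesis
    unfolding seminorm_topology_def topology_generated_by_topspace by blast
qed

text \<open>Isomorphism of topological vector spaces whose carriers are the topological spaces
  \<open>X\<close> and \<open>Y\<close>, with pointwise addition and complex scalar multiplication.\<close>

definition tvs_isomorphic ::
    "('a \<Rightarrow> complex) topology \<Rightarrow> ('b \<Rightarrow> complex) topology \<Rightarrow> bool" where
  "tvs_isomorphic X Y \<longleftrightarrow>
     (\<exists>T. homeomorphic_map X Y T \<and>
       (\<forall>f\<in>topspace X. \<forall>g\<in>topspace X. T (\<lambda>x. f x + g x) = (\<lambda>z. T f z + T g z)) \<and>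
       (\<forall>c. \<forall>f\<in>topspace X. T (\<lambda>x. c * f x) = (\<lambda>z. c * T f z)))"

section \<open>The spaces \<open>G(M,\<Phi>)\<close> and \<open>E(K,\<Phi>)\<close>\<close>

definition log_convex :: "(nat \<Rightarrow> real) \<Rightarrow> bool" where
  "log_convex K \<longleftrightarrow> (\<forall>m\<ge>1. (K m)\<^sup>2 \<le> K (m - 1) * K (m + 1))"

text \<open>The supremum is taken in the reals; it is the intended one whenever \<open>K\<close> grows faster than
  every geometric sequence, since only then the set is bounded above for every \<open>r\<close>.\<close>

definition w :: "(nat \<Rightarrow> real) \<Rightarrow> real \<Rightarrow> real" where
  "w K r = (if r = 0 then 0 else (SUP m. ln (r ^ m / K m)))"

definition p_norm :: "(nat \<Rightarrow> real) \<Rightarrow> (nat \<Rightarrow> real^'n::finite \<Rightarrow> real) \<Rightarrow> nat \<Rightarrow> real \<Rightarrow>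
    (real^'n \<Rightarrow> complex) \<Rightarrow> ereal" where
  "p_norm M \<phi> m \<epsilon> f = (SUP (x, \<alpha>) \<in> UNIV.
     ereal (cmod (mi_deriv \<alpha> f x) / (\<epsilon> ^ mi_order \<alpha> * M (mi_order \<alpha>) * exp (\<phi> m x))))"

definition G_space_step :: "(nat \<Rightarrow> real) \<Rightarrow> (nat \<Rightarrow> real^'n::finite \<Rightarrow> real) \<Rightarrow> nat \<Rightarrow> real \<Rightarrow>
    (real^'n \<Rightarrow> complex) set" where
  "G_space_step M \<phi> m \<epsilon> = {f. smooth f \<and> p_norm M \<phi> m \<epsilon> f < \<infinity>}"

definition G_space :: "(nat \<Rightarrow> real) \<Rightarrow> (nat \<Rightarrow> real^'n::finite \<Rightarrow> real) \<Rightarrow>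
    (real^'n \<Rightarrow> complex) set" where
  "G_space M \<phi> = (\<Inter>m\<in>{1..}. \<Inter>\<epsilon>\<in>{0<..}. G_space_step M \<phi> m \<epsilon>)"

definition G_top :: "(nat \<Rightarrow> real) \<Rightarrow> (nat \<Rightarrow> real^'n::finite \<Rightarrow> real) \<Rightarrow>
    (real^'n \<Rightarrow> complex) topology" where
  "G_top M \<phi> = seminorm_topology (G_space M \<phi>) {p_norm M \<phi> m \<epsilon> | m \<epsilon>. 1 \<le> m \<and> 0 < \<epsilon>}"

definition E_space :: "(nat \<Rightarrow> real) \<Rightarrow> (nat \<Rightarrow> real^'n::finite \<Rightarrow> real) \<Rightarrow>
    (complex^'n \<Rightarrow> complex) set" where
  "E_space K \<phi> = {f. entire f \<and> (\<forall>m\<ge>1. \<forall>\<epsilon>>0. \<exists>c>0. \<forall>z.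
     cmod (f z) \<le> c * exp (\<phi> m (Re_vec z) + w K (\<epsilon> * norm (Im_vec z))))}"

definition q_norm :: "(nat \<Rightarrow> real) \<Rightarrow> (nat \<Rightarrow> real^'n::finite \<Rightarrow> real) \<Rightarrow> nat \<Rightarrow> real \<Rightarrow>
    (complex^'n \<Rightarrow> complex) \<Rightarrow> ereal" where
  "q_norm K \<phi> m \<epsilon> f =
     (SUP z. ereal (cmod (f z) / exp (\<phi> m (Re_vec z) + w K (\<epsilon> * norm (Im_vec z)))))"

definition E_top :: "(nat \<Rightarrow> real) \<Rightarrow> (nat \<Rightarrow> real^'n::finite \<Rightarrow> real) \<Rightarrow>
    (complex^'n \<Rightarrow> complex) topology" where
  "E_top K \<phi> = seminorm_topology (E_space K \<phi>) {q_norm K \<phi> m \<epsilon> | m \<epsilon>. 1 \<le> m \<and> 0 < \<epsilon>}"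

lemma iter_partial_zero: "iter_partial is (\<lambda>x. 0) = (\<lambda>x. 0)"
  by (induction "is") (auto simp: partial_deriv_def)

lemma p_norm_zero: "p_norm M \<phi> m \<epsilon> (\<lambda>x. 0) = 0"
  by (simp add: p_norm_def mi_deriv_def iter_partial_zero case_prod_unfold zero_ereal_def)

lemma q_norm_zero: "q_norm K \<phi> m \<epsilon> (\<lambda>z. 0) = 0"
  by (simp add: q_norm_def zero_ereal_def)

lemma topspace_G_top: "topspace (G_top M \<phi>) = G_space M \<phi>"
  unfolding G_top_def
proof (rule topspace_seminorm_topology)
  have "p_norm M \<phi> 1 1 \<in> {p_norm M \<phi> m \<epsilon> | m \<epsilon>. 1 \<le> m \<and> 0 < \<epsilon>}"
    using zero_less_one by blast
  then show "{p_norm M \<phi> m \<epsilon> | m \<epsilon>. 1 \<le> m \<and> 0 < \<epsilon>} \<noteq> {}" by blast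
qed (auto simp: p_norm_zero)

lemma topspace_E_top: "topspace (E_top K \<phi>) = E_space K \<phi>"
  unfolding E_top_def
proof (rule topspace_seminorm_topology)
  have "q_norm K \<phi> 1 1 \<in> {q_norm K \<phi> m \<epsilon> | m \<epsilon>. 1 \<le> m \<and> 0 < \<epsilon>}"
    using zero_less_one by blast
  then show "{q_norm K \<phi> m \<epsilon> | m \<epsilon>. 1 \<le> m \<and> 0 < \<epsilon>} \<noteq> {}" by blast
qed (auto simp: q_norm_zero)

end

theory Submission
  imports Defs "HOL-Complex_Analysis.Conformal_Mappings"
begin

text \<open>Restriction to the real subspace is the inverse of the isomorphism. A function \<open>f\<close> in
  \<open>G(M,\<Phi>)\<close> has an everywhere convergent Taylor series, since \<open>M\<^sub>k / k!\<close> decays faster than every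
  geometric sequence; re-expanding it at \<open>x\<close> and using \<open>M\<^sub>k / k! \<le> t1 t2\<^sup>k / K\<^sub>k\<close> bounds the
  extension at \<open>x + iy\<close> by \<open>e\<^sup>\<phi> \<Sum> (c \<epsilon> \<parallel>y\<parallel>)\<^sup>k / K\<^sub>k\<close>, which is controlled by \<open>w\<^sub>K\<close>.
  Conversely, Cauchy's estimates for an entire function on balls of radius \<open>R\<close> produce
  \<open>k! R\<^sup>-\<^sup>k e\<^sup>2\<^sup>w\<close> with \<open>w = w\<^sub>K(a \<delta> R)\<close>. Log-convexity of \<open>M\<close> makes \<open>K\<close> submultiplicative up to a
  geometric factor, so that \<open>2 w\<^sub>K(r) \<le> w\<^sub>K(d r) + const\<close>, and log-convexity of \<open>K\<close> gives
  \<open>inf\<^sub>r e\<^sup>w r\<^sup>-\<^sup>k = 1 / K\<^sub>k\<close>, attained at \<open>r = K\<^sub>k\<^sub>+\<^sub>1 / K\<^sub>k\<close>.\<close>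

section \<open>Smooth functions and symmetry of partial derivatives\<close>

text \<open>The two copies of the weight in Cauchy's estimate have different origins: one is the
  growth of the entire function in the imaginary directions, the other is the price, in condition
  3), of moving the real centre by at most R. That condition also lowers the index from m + 1 to m,
  while extension keeps m; the loss is harmless because both spaces impose bounds for every m.
  Likewise every geometric factor c^k (from counting index lists, from k^k against k!, from t2, from
  doubling the weight) is absorbed by rescaling the free parameter \<epsilon> or \<delta>. Two
  obstacles shape the work. The extension is a power series at 0, but its bound at z needs the
  derivatives at Re z; instead of rearranging a double series, both expansions are seen to be entire
  and to agree on real displacements, which forces equality. And derivatives of entire functions are
  handled inside the class of continuous functions holomorphic in each variable, which one-variable
  theory shows to be closed under partial differentiation.\<close>

lemma vector_derivative_bound_interval:
  fixes u :: "real \<Rightarrow> 'a::real_normed_vector"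
  assumes "0 \<le> h" and "\<And>t. 0 \<le> t \<Longrightarrow> t \<le> h \<Longrightarrow> (u has_vector_derivative u' t) (at t)"
    and "\<And>t. 0 \<le> t \<Longrightarrow> t \<le> h \<Longrightarrow> norm (u' t) \<le> B"
  shows "norm (u h - u 0) \<le> B * h"
proof -
  have "norm (u h - u 0) \<le> B * norm (h - 0)"
  proof (rule differentiable_bound[where S = "{0..h}" and f' = "\<lambda>t s. s *\<^sub>R u' t"])
    fix t assume t: "t \<in> {0..h}"
    show "(u has_derivative (\<lambda>s. s *\<^sub>R u' t)) (at t within {0..h})"
      using assms(2)[of t] t by (auto simp: has_vector_derivative_def intro: has_derivative_at_withinI)
    show "onorm (\<lambda>s. s *\<^sub>R u' t) \<le> B"
      using assms(3)[of t] t by (intro onorm_le) (auto simp: mult.commute[of B] intro: mult_left_mono)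
  qed (use assms(1) in auto)
  then show ?thesis using assms(1) by simp
qed

text \<open>Differentiability is assumed at parameter 0 only, but for every base point, so moving
  the base point along the axis covers every parameter.\<close>

lemma partial_deriv_along_axis:
  assumes "\<And>x. (\<lambda>t::real. f (x + t *\<^sub>R axis i 1)) differentiable (at 0)"
  shows "((\<lambda>t. f (x + t *\<^sub>R axis i 1)) has_vector_derivative partial_deriv i f (x + t *\<^sub>R axis i 1)) (at t)"
proof -
  let ?g = "\<lambda>s::real. f ((x + t *\<^sub>R axis i 1) + s *\<^sub>R axis i 1)"
  have "(?g has_vector_derivative partial_deriv i f (x + t *\<^sub>R axis i 1)) (at (t - t))"
    using assms[of "x + t *\<^sub>R axis i 1"] unfolding partial_deriv_def
    by (simp add: vector_derivative_works)
  moreover have "((\<lambda>s. s - t) has_vector_derivative 1) (at t)"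
    by (auto intro!: derivative_eq_intros)
  ultimately have "((?g \<circ> (\<lambda>s. s - t)) has_vector_derivative 1 *\<^sub>R partial_deriv i f (x + t *\<^sub>R axis i 1)) (at t)"
    by (intro vector_diff_chain_at) auto
  moreover have "?g \<circ> (\<lambda>s. s - t) = (\<lambda>t. f (x + t *\<^sub>R axis i 1))"
    by (auto simp: fun_eq_iff algebra_simps scaleR_diff_left)
  ultimately show ?thesis by simp
qed

text \<open>The coordinates of the increment are switched on one at a time, which makes each move a
  one-variable problem. The set \<open>S\<close> of the induction collects the coordinates already
  moved.\<close>

lemma has_derivative_continuous_partials:
  fixes f :: "real^'n::finite \<Rightarrow> complex"
  assumes cont: "\<And>i. continuous_on UNIV (partial_deriv i f)"
    and diff: "\<And>i x. (\<lambda>t::real. f (x + t *\<^sub>R axis i 1)) differentiable (at 0)"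
  shows "(f has_derivative (\<lambda>v. \<Sum>i\<in>UNIV. v $ i *\<^sub>R partial_deriv i f x)) (at x)"
  unfolding has_derivative_at_alt
proof (intro conjI allI impI)
  show "bounded_linear (\<lambda>v. \<Sum>i\<in>UNIV. v $ i *\<^sub>R partial_deriv i f x)"
    by (intro bounded_linear_sum bounded_linear_compose[OF bounded_linear_scaleR_left]
        bounded_linear_vec_nth)
next
  fix e :: real assume e: "0 < e"
  \<comment> \<open>Each of the \<open>CARD('n)\<close> moves costs 3 e' times the norm of the
    increment: 2 e' for linearising along the segment, and e' for replacing the partial derivative
    at the intermediate point by the one at \<open>x\<close>.\<close>
  define e' where "e' = e / (3 * real CARD('n))"
  have e': "e' > 0" using e by (simp add: e'_def)
  have "\<forall>\<^sub>F y in nhds x. \<forall>i. dist (partial_deriv i f y) (partial_deriv i f x) < e'"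
  proof (rule eventually_all_finite)
    fix i
    have "isCont (partial_deriv i f) x"
      using cont[of i] by (simp add: continuous_on_eq_continuous_at)
    then show "\<forall>\<^sub>F y in nhds x. dist (partial_deriv i f y) (partial_deriv i f x) < e'"
      using e' by (auto simp: continuous_at eventually_nhds_conv_at dest: tendstoD)
  qed
  then obtain d where d: "d > 0" and
    D: "\<And>y i. dist y x < d \<Longrightarrow> dist (partial_deriv i f y) (partial_deriv i f x) < e'"
    unfolding eventually_nhds_metric by blast
  have claim: "norm (f (x + (\<chi> j. if j \<in> S then v $ j else 0)) - f x
      - (\<Sum>i\<in>S. v $ i *\<^sub>R partial_deriv i f x)) \<le> real (card S) * (3 * e' * norm v)"
    if "finite S" "norm v < d" for S and v :: "real^'n"
    using that(1)
  proof (induction S)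
    case empty
    have "(\<chi> j. 0) = (0 :: real^'n)" by (simp add: vec_eq_iff)
    then show ?case by simp
  next
    case (insert i S)
    define y where "y = x + (\<chi> j. if j \<in> S then v $ j else 0)"
    have split: "x + (\<chi> j. if j \<in> insert i S then v $ j else 0) = y + v $ i *\<^sub>R axis i 1"
      using insert.hyps by (auto simp: y_def vec_eq_iff axis_def)
    \<comment> \<open>Dropping or shortening coordinates does not increase the norm, so the whole
      broken path stays in the ball where the partials are controlled.\<close>
    have near: "dist (y + t *\<^sub>R axis i 1) x < d" if "t \<in> closed_segment 0 (v $ i)" for t
    proof -
      have t: "\<bar>t\<bar> \<le> \<bar>v $ i\<bar>" using that by (auto simp: closed_segment_eq_real_ivl split: if_splits)
      have "norm ((\<chi> j. if j \<in> S then v $ j else 0) + t *\<^sub>R axis i 1) \<le> norm v"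
        using t insert.hyps by (intro norm_le_componentwise_cart) (auto simp: axis_def)
      then show ?thesis using that \<open>norm v < d\<close> by (simp add: y_def dist_norm add.assoc)
    qed
    have "norm (f (y + v $ i *\<^sub>R axis i 1) - f (y + 0 *\<^sub>R axis i 1)
        - (v $ i - 0) *\<^sub>R partial_deriv i f (y + 0 *\<^sub>R axis i 1)) \<le> norm (v $ i - 0) * (2 * e')"
    proof (rule vector_differentiable_bound_linearization[where S = "closed_segment 0 (v $ i)"
          and f' = "\<lambda>t. partial_deriv i f (y + t *\<^sub>R axis i 1)"])
      fix t assume t: "t \<in> closed_segment 0 (v $ i)"
      show "((\<lambda>t. f (y + t *\<^sub>R axis i 1)) has_vector_derivative
          partial_deriv i f (y + t *\<^sub>R axis i 1)) (at t within closed_segment 0 (v $ i))"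
        by (rule has_vector_derivative_at_within[OF partial_deriv_along_axis[OF diff]])
      show "norm (partial_deriv i f (y + t *\<^sub>R axis i 1)
          - partial_deriv i f (y + 0 *\<^sub>R axis i 1)) \<le> 2 * e'"
        using D[OF near[OF t], of i] D[OF near[of 0], of i]
          dist_triangle2[of "partial_deriv i f (y + t *\<^sub>R axis i 1)"
            "partial_deriv i f (y + 0 *\<^sub>R axis i 1)" "partial_deriv i f x"]
        by (simp add: dist_norm)
    qed auto
    then have 1: "norm (f (y + v $ i *\<^sub>R axis i 1) - f y - v $ i *\<^sub>R partial_deriv i f y)
        \<le> norm v * (2 * e')"
      using component_le_norm_cart[of v i] e'
      by (smt (verit, best) add.right_neutral diff_zero mult_right_mono real_norm_def scale_zero_left)
    have "norm (v $ i *\<^sub>R partial_deriv i f y - v $ i *\<^sub>R partial_deriv i f x) \<le> norm v * e'"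
      using component_le_norm_cart[of v i] D[OF near[of 0], of i]
      by (auto simp flip: scaleR_diff_right simp: dist_norm intro!: mult_mono)
    then have "norm (f (y + v $ i *\<^sub>R axis i 1) - f y - v $ i *\<^sub>R partial_deriv i f x)
        \<le> norm v * (2 * e') + norm v * e'"
      using 1 norm_triangle_ineq[of "f (y + v $ i *\<^sub>R axis i 1) - f y - v $ i *\<^sub>R partial_deriv i f y"
          "v $ i *\<^sub>R partial_deriv i f y - v $ i *\<^sub>R partial_deriv i f x"]
      by (simp add: add_diff_eq mult_ac)
    moreover have "norm (f y - f x - (\<Sum>i\<in>S. v $ i *\<^sub>R partial_deriv i f x))
        \<le> real (card S) * (3 * e' * norm v)"
      using insert.IH by (simp add: y_def)
    ultimately have "norm (f (y + v $ i *\<^sub>R axis i 1) - f x - (\<Sum>i\<in>insert i S. v $ i *\<^sub>R partial_deriv i f x))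
        \<le> norm v * (2 * e') + norm v * e' + real (card S) * (3 * e' * norm v)"
      using insert.hyps norm_triangle_ineq[of "f (y + v $ i *\<^sub>R axis i 1) - f y - v $ i *\<^sub>R partial_deriv i f x"
          "f y - f x - (\<Sum>i\<in>S. v $ i *\<^sub>R partial_deriv i f x)"]
      by (simp add: algebra_simps)
    also have "\<dots> = real (card (insert i S)) * (3 * e' * norm v)"
      using insert.hyps by (simp add: algebra_simps)
    finally show ?case unfolding split .
  qed
  show "\<exists>d>0. \<forall>y. norm (y - x) < d \<longrightarrow> norm (f y - f x -
      (\<Sum>i\<in>UNIV. (y - x) $ i *\<^sub>R partial_deriv i f x)) \<le> e * norm (y - x)"
  proof (intro exI[of _ d] conjI allI impI)
    fix y assume "norm (y - x) < d"
    moreover have "x + (\<chi> j. (y - x) $ j) = y" by (simp add: vec_eq_iff)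
    ultimately have "norm (f y - f x - (\<Sum>i\<in>UNIV. (y - x) $ i *\<^sub>R partial_deriv i f x))
        \<le> real CARD('n) * (3 * e' * norm (y - x))"
      using claim[of UNIV "y - x"] by simp
    also have "\<dots> = e * norm (y - x)" by (simp add: e'_def)
    finally show "norm (f y - f x - (\<Sum>i\<in>UNIV. (y - x) $ i *\<^sub>R partial_deriv i f x)) \<le> e * norm (y - x)" .
  qed (fact d)
qed

lemma iter_partial_append: "iter_partial (xs @ ys) f = iter_partial xs (iter_partial ys f)"
  by (induction xs) auto

lemma smooth_iter_partial: "smooth f \<Longrightarrow> smooth (iter_partial js f)"
  unfolding smooth_def by (auto simp flip: iter_partial_append)

lemma smooth_partial_deriv: "smooth f \<Longrightarrow> smooth (partial_deriv i f)"
  using smooth_iter_partial[of f "[i]"] by simp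

lemma smoothD:
  assumes "smooth f"
  shows "continuous_on UNIV f" "(\<lambda>t::real. f (x + t *\<^sub>R axis i 1)) differentiable (at 0)"
  using assms[unfolded smooth_def, rule_format, of "[]"] by auto

lemma smooth_has_derivative:
  "smooth f \<Longrightarrow> (f has_derivative (\<lambda>v. \<Sum>i\<in>UNIV. v $ i *\<^sub>R partial_deriv i f x)) (at x)"
  by (intro has_derivative_continuous_partials) (auto intro: smoothD smooth_partial_deriv)

lemma smooth_along_line:
  assumes "smooth f"
  shows "((\<lambda>t. f (x + t *\<^sub>R v)) has_vector_derivative
    (\<Sum>i\<in>UNIV. v $ i *\<^sub>R partial_deriv i f (x + t *\<^sub>R v))) (at t)"
proof -
  have "((\<lambda>t. x + t *\<^sub>R v) has_vector_derivative v) (at t)"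
    by (auto intro!: derivative_eq_intros)
  from vector_derivative_diff_chain_within[OF this
      has_derivative_at_withinI[OF smooth_has_derivative[OF assms]]]
  show ?thesis by (simp add: o_def)
qed

text \<open>The mean value inequality is used twice: along axis \<open>j\<close> for a difference in
  direction \<open>i\<close>, then along axis \<open>i\<close> for the derivative of that
  difference. Two displacements of length at most \<open>h\<close> explain the radius
  \<open>2 * h\<close>.\<close>

lemma second_difference_bound:
  fixes f :: "real^'n::finite \<Rightarrow> complex"
  assumes f: "smooth f" and h: "0 \<le> h"
    and A: "\<And>y. norm (y - x) \<le> 2 * h \<Longrightarrow> norm (partial_deriv i (partial_deriv j f) y - A) \<le> e"
  shows "norm (f (x + h *\<^sub>R axis i 1 + h *\<^sub>R axis j 1) - f (x + h *\<^sub>R axis i 1)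
    - f (x + h *\<^sub>R axis j 1) + f x - (h * h) *\<^sub>R A) \<le> e * h * h"
proof -
  let ?u = "\<lambda>t. f ((x + h *\<^sub>R axis i 1) + t *\<^sub>R axis j 1) - f (x + t *\<^sub>R axis j 1) - (t * h) *\<^sub>R A"
  let ?u' = "\<lambda>t. partial_deriv j f ((x + h *\<^sub>R axis i 1) + t *\<^sub>R axis j 1)
      - partial_deriv j f (x + t *\<^sub>R axis j 1) - h *\<^sub>R A"
  have "norm (?u h - ?u 0) \<le> (e * h) * h"
  proof (rule vector_derivative_bound_interval[OF h, where u' = ?u'])
    fix t assume t: "0 \<le> t" "t \<le> h"
    show "(?u has_vector_derivative ?u' t) (at t)"
      by (auto intro!: derivative_eq_intros partial_deriv_along_axis smoothD[OF f])
    let ?v = "\<lambda>s. partial_deriv j f ((x + t *\<^sub>R axis j 1) + s *\<^sub>R axis i 1) - s *\<^sub>R A"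
    let ?v' = "\<lambda>s. partial_deriv i (partial_deriv j f) ((x + t *\<^sub>R axis j 1) + s *\<^sub>R axis i 1) - A"
    have "norm (?v h - ?v 0) \<le> e * h"
    proof (rule vector_derivative_bound_interval[OF h, where u' = ?v'])
      fix s assume s: "0 \<le> s" "s \<le> h"
      show "(?v has_vector_derivative ?v' s) (at s)"
        by (auto intro!: derivative_eq_intros partial_deriv_along_axis smoothD smooth_partial_deriv f)
      have "norm (t *\<^sub>R axis j 1 + s *\<^sub>R axis i 1 :: real^'n) \<le> 2 * h"
        using norm_triangle_ineq[of "t *\<^sub>R axis j 1" "s *\<^sub>R axis i 1 :: real^'n"] s t by simp
      then show "norm (?v' s) \<le> e" by (intro A) (simp add: add.assoc)
    qed
    then show "norm (?u' t) \<le> e * h" by (simp add: algebra_simps)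
  qed
  then show ?thesis by (simp add: algebra_simps)
qed

text \<open>The second difference is symmetric in \<open>i\<close> and \<open>j\<close>, so it
  approximates h^2 times either mixed partial with error (e/2) h^2; continuity of the mixed partials
  supplies the error bound.\<close>

lemma partial_deriv_commute:
  fixes f :: "real^'n::finite \<Rightarrow> complex"
  assumes f: "smooth f"
  shows "partial_deriv i (partial_deriv j f) = partial_deriv j (partial_deriv i f)"
proof
  fix x
  let ?A = "partial_deriv i (partial_deriv j f)" and ?B = "partial_deriv j (partial_deriv i f)"
  have "norm (?A x - ?B x) \<le> 0 + e" if e: "e > 0" for e
  proof -
    have "isCont ?A x" "isCont ?B x"
      using smoothD(1)[OF smooth_partial_deriv[OF smooth_partial_deriv[OF f]]]
      by (auto simp: continuous_on_eq_continuous_at)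
    then have "\<forall>\<^sub>F y in nhds x. dist (?A y) (?A x) < e/2 \<and> dist (?B y) (?B x) < e/2"
      using e by (auto simp: continuous_at eventually_nhds_conv_at eventually_conj_iff dest: tendstoD[of _ _ _ "e/2"])
    then obtain d where d: "d > 0" and
      D: "\<And>y. dist y x < d \<Longrightarrow> dist (?A y) (?A x) < e/2 \<and> dist (?B y) (?B x) < e/2"
      unfolding eventually_nhds_metric by blast
    define h where "h = d / 3"
    have h: "h > 0" "2 * h < d" using d by (auto simp: h_def)
    let ?D = "f (x + h *\<^sub>R axis i 1 + h *\<^sub>R axis j 1) - f (x + h *\<^sub>R axis i 1)
      - f (x + h *\<^sub>R axis j 1) + f x"
    have 1: "norm (?D - (h * h) *\<^sub>R ?A x) \<le> (e/2) * h * h"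
      using h D by (intro second_difference_bound[OF f]) (fastforce simp: dist_norm less_imp_le)+
    have "norm (f (x + h *\<^sub>R axis j 1 + h *\<^sub>R axis i 1) - f (x + h *\<^sub>R axis j 1)
      - f (x + h *\<^sub>R axis i 1) + f x - (h * h) *\<^sub>R ?B x) \<le> (e/2) * h * h"
      using h D by (intro second_difference_bound[OF f]) (fastforce simp: dist_norm less_imp_le)+
    then have 2: "norm (?D - (h * h) *\<^sub>R ?B x) \<le> (e/2) * h * h"
      by (simp add: algebra_simps)
    have "norm ((h * h) *\<^sub>R (?A x - ?B x)) \<le> (e/2) * h * h + (e/2) * h * h"
      using norm_triangle_ineq4[of "?D - (h * h) *\<^sub>R ?B x" "?D - (h * h) *\<^sub>R ?A x"] 1 2
      by (simp add: algebra_simps)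
    then have "(h * h) * norm (?A x - ?B x) \<le> (h * h) * e"
      unfolding norm_scaleR using h by (simp add: algebra_simps)
    then show ?thesis using h by (simp add: mult_le_cancel_left_pos)
  qed
  then have "norm (?A x - ?B x) \<le> 0" by (rule field_le_epsilon)
  then show "?A x = ?B x" by simp
qed

lemma iter_partial_Cons_commute:
  "smooth f \<Longrightarrow> iter_partial xs (partial_deriv i f) = partial_deriv i (iter_partial xs f)"
  by (induction xs) (auto simp: partial_deriv_commute smooth_iter_partial)

text \<open>It suffices to move one derivative past a list: the head of \<open>xs\<close> is located
  in \<open>ys\<close> and pulled to the front.\<close>

lemma iter_partial_mset_cong:
  assumes "smooth f" "mset xs = mset ys"
  shows "iter_partial xs f = iter_partial ys f"
  using assms(2)
proof (induction xs arbitrary: ys)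
  case (Cons x xs)
  then have "x \<in> set ys" by (metis list.set_intros(1) mset_eq_setD)
  then obtain as bs where ys: "ys = as @ x # bs" by (meson split_list)
  have "mset xs = mset (as @ bs)" using Cons.prems by (simp add: ys)
  then have "iter_partial xs f = iter_partial (as @ bs) f" by (rule Cons.IH)
  then show ?case
    by (simp add: ys iter_partial_append iter_partial_Cons_commute smooth_iter_partial assms(1))
qed simp

section \<open>Index lists against multi-indices\<close>

lemma count_list_ex: "\<exists>xs. \<forall>i. count_list xs i = (\<alpha> :: 'n::finite \<Rightarrow> nat) i"
proof -
  have "finite {i. 0 < \<alpha> i}" by simp
  then obtain m where m: "count m = \<alpha>" using count_Abs_multiset by blast
  obtain xs where "mset xs = m" by (metis ex_mset)
  then show ?thesis using m by (auto simp flip: count_mset)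
qed

lemma mi_deriv_iter_partial:
  obtains xs where "mi_deriv \<alpha> f = iter_partial xs f" "length xs = mi_order \<alpha>"
proof
  let ?xs = "SOME xs. \<forall>i. count_list xs i = \<alpha> i"
  have "\<forall>i. count_list ?xs i = \<alpha> i" by (rule someI_ex[OF count_list_ex])
  then show "length ?xs = mi_order \<alpha>"
    using sum_count_set[of ?xs UNIV] by (simp add: mi_order_def)
qed (rule mi_deriv_def)

text \<open>The list picked by \<open>SOME\<close> in \<open>mi_deriv\<close> is a permutation of
  \<open>xs\<close>, so symmetry identifies the two derivatives. This allows later estimates to
  range over index lists.\<close>

lemma iter_partial_mi_deriv:
  assumes "smooth f"
  shows "iter_partial xs f = mi_deriv (count_list xs) f" "mi_order (count_list xs) = length xs"
proof -
  let ?ys = "SOME ys. \<forall>i. count_list ys i = count_list xs i"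
  have "\<forall>i. count_list ?ys i = count_list xs i" by (rule someI_ex[OF count_list_ex])
  then have "mset xs = mset ?ys" by (intro multiset_eqI) (simp add: count_mset)
  then show "iter_partial xs f = mi_deriv (count_list xs) f"
    unfolding mi_deriv_def by (rule iter_partial_mset_cong[OF assms])
  show "mi_order (count_list xs) = length xs"
    using sum_count_set[of xs UNIV] by (simp add: mi_order_def)
qed

section \<open>Separately entire functions\<close>

text \<open>Joint continuity is included because it gives uniform continuity on balls, which makes
  one-variable Cauchy estimates uniform in the remaining coordinates.\<close>

definition separately_entire :: "(complex^'n::finite \<Rightarrow> complex) \<Rightarrow> bool" where
  "separately_entire F \<longleftrightarrow>
     continuous_on UNIV F \<and> (\<forall>i z. (\<lambda>t. F (z + axis i t)) holomorphic_on UNIV)"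

definition cpartial :: "'n::finite \<Rightarrow> (complex^'n \<Rightarrow> complex) \<Rightarrow> complex^'n \<Rightarrow> complex" where
  "cpartial i F z = deriv (\<lambda>t. F (z + axis i t)) 0"

primrec iter_cpartial :: "'n::finite list \<Rightarrow> (complex^'n \<Rightarrow> complex) \<Rightarrow> complex^'n \<Rightarrow> complex" where
  "iter_cpartial [] F = F"
| "iter_cpartial (i # is) F = cpartial i (iter_cpartial is F)"

definition complexify :: "real^'n::finite \<Rightarrow> complex^'n" where
  "complexify x = (\<chi> i. complex_of_real (x $ i))"

lemma axis_plus: "axis i (s + t) = axis i s + axis i (t :: 'a::monoid_add)"
  by (simp add: vec_eq_iff axis_def)

lemma axis_zero [simp]: "axis i 0 = 0"
  by simp

lemma norm_axis: "norm (axis i t) = norm t"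
proof -
  have "(norm (axis i t $ j))\<^sup>2 = (if j = i then (norm t)\<^sup>2 else 0)" for j
    by (auto simp: axis_def)
  then show ?thesis unfolding norm_vec_def L2_set_def by simp
qed

lemma bounded_linear_axis: "bounded_linear (axis i :: 'a::real_normed_vector \<Rightarrow> 'a^'n::finite)"
proof (rule bounded_linear_intro[where K = 1])
  fix x y :: 'a and r :: real
  show "axis i (x + y) = axis i x + axis i y" by (rule axis_plus)
  show "axis i (r *\<^sub>R x) = r *\<^sub>R axis i x" by (simp add: vec_eq_iff axis_def)
qed (simp add: norm_axis)

section \<open>One-variable Cauchy estimates and closure under partial differentiation\<close>

lemma separately_entire_field_derivative:
  assumes "separately_entire F"
  shows "((\<lambda>t. F (z + axis i t)) has_field_derivative cpartial i F (z + axis i t)) (at t)"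
proof -
  let ?g = "\<lambda>s. F ((z + axis i t) + axis i s)"
  have "?g holomorphic_on UNIV" using assms by (simp add: separately_entire_def)
  then have "(?g has_field_derivative cpartial i F (z + axis i t)) (at (t + - t))"
    unfolding cpartial_def by (simp add: holomorphic_derivI)
  then have "((\<lambda>s. ?g (s + - t)) has_field_derivative cpartial i F (z + axis i t)) (at t)"
    by (simp only: DERIV_at_within_shift_lemma DERIV_shift)
  moreover have "(\<lambda>s. ?g (s + - t)) = (\<lambda>s. F (z + axis i s))"
    by (simp add: add.assoc flip: axis_plus)
  ultimately show ?thesis by simp
qed

text \<open>Cauchy's inequality for the difference of two slices turns closeness of \<open>F\<close>
  on a circle into closeness of the derivatives at the centres; this is how continuity passes from
  \<open>F\<close> to \<open>cpartial i F\<close>.\<close>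

lemma cpartial_diff_bound:
  assumes F: "separately_entire F" and r: "0 < r"
    and B: "\<And>t. norm t = r \<Longrightarrow> norm (F (z + axis i t) - F (z' + axis i t)) \<le> B"
  shows "norm (cpartial i F z - cpartial i F z') \<le> B / r"
proof -
  let ?g = "\<lambda>t. F (z + axis i t) - F (z' + axis i t)"
  have hol: "?g holomorphic_on UNIV"
    using F by (auto simp: separately_entire_def intro!: holomorphic_intros)
  have "norm ((deriv ^^ 1) ?g 0) \<le> fact 1 * B / r ^ 1"
  proof (rule Cauchy_inequality[OF _ _ r])
    show "?g holomorphic_on ball 0 r" using hol by (rule holomorphic_on_subset) simp
    show "continuous_on (cball 0 r) ?g"
      by (rule holomorphic_on_imp_continuous_on[OF holomorphic_on_subset[OF hol]]) simp
  qed (use B in auto)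
  moreover have "deriv ?g 0 = cpartial i F z - cpartial i F z'"
    using separately_entire_field_derivative[OF F, of z i 0]
      separately_entire_field_derivative[OF F, of z' i 0]
    by (intro DERIV_imp_deriv) (auto intro!: derivative_eq_intros)
  ultimately show ?thesis by simp
qed

lemma cpartial_bound:
  assumes F: "separately_entire F" and r: "0 < r"
    and B: "\<And>t. norm t = r \<Longrightarrow> norm (F (z + axis i t)) \<le> B"
  shows "norm (cpartial i F z) \<le> B / r"
proof -
  let ?g = "\<lambda>t. F (z + axis i t)"
  have hol: "?g holomorphic_on UNIV"
    using F by (auto simp: separately_entire_def)
  have "norm ((deriv ^^ 1) ?g 0) \<le> fact 1 * B / r ^ 1"
  proof (rule Cauchy_inequality[OF _ _ r])
    show "?g holomorphic_on ball 0 r" using hol by (rule holomorphic_on_subset) simp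
    show "continuous_on (cball 0 r) ?g"
      by (rule holomorphic_on_imp_continuous_on[OF holomorphic_on_subset[OF hol]]) simp
  qed (use B in auto)
  then show ?thesis by (simp add: cpartial_def)
qed

lemma uniformly_near_on_cball:
  fixes F :: "complex^'n::finite \<Rightarrow> complex"
  assumes "continuous_on UNIV F" "0 < e"
  obtains d where "0 < d" "\<And>y y'. norm y \<le> R \<Longrightarrow> norm y' \<le> R \<Longrightarrow> norm (y - y') < d \<Longrightarrow> norm (F y - F y') < e"
proof -
  have "uniformly_continuous_on (cball 0 R) F"
    by (intro compact_uniformly_continuous continuous_on_subset[OF assms(1)]) auto
  then obtain d where d: "0 < d" and
    D: "\<And>y y' :: complex^'n. y \<in> cball 0 R \<Longrightarrow> y' \<in> cball 0 R \<Longrightarrow> dist y' y < d \<Longrightarrow> dist (F y') (F y) < e"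
    using assms(2) unfolding uniformly_continuous_on_def by meson
  show ?thesis
  proof (rule that[OF d])
    fix y y' :: "complex^'n" assume "norm y \<le> R" "norm y' \<le> R" "norm (y - y') < d"
    then show "norm (F y - F y') < e" using D[of y' y] by (simp add: dist_norm)
  qed
qed

lemma continuous_on_cpartial:
  fixes F :: "complex^'n::finite \<Rightarrow> complex"
  assumes F: "separately_entire F"
  shows "continuous_on UNIV (cpartial i F)"
  unfolding continuous_on_iff
proof (intro ballI allI impI)
  fix z0 :: "complex^'n" and e :: real assume "0 < e"
  then have e: "0 < e / 2" by simp
  have contF: "continuous_on UNIV F" using F by (simp add: separately_entire_def)
  \<comment> \<open>The 2 consists of 1 for the distance from \<open>z\<close> to \<open>z0\<close>
    and 1 for the radius of the circle in Cauchy's inequality.\<close>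
  obtain d where d: "0 < d" and D: "\<And>y y'. norm y \<le> norm z0 + 2 \<Longrightarrow> norm y' \<le> norm z0 + 2 \<Longrightarrow>
      norm (y - y') < d \<Longrightarrow> norm (F y - F y') < e / 2"
    using uniformly_near_on_cball[OF contF e] by blast
  show "\<exists>d>0. \<forall>z\<in>UNIV. dist z z0 < d \<longrightarrow> dist (cpartial i F z) (cpartial i F z0) < e"
  proof (intro exI[of _ "min d 1"] conjI ballI impI)
    fix z assume z: "dist z z0 < min d 1"
    have "norm (F (z + axis i t) - F (z0 + axis i t)) \<le> e / 2" if "norm t = 1" for t
    proof -
      have "norm (z + axis i t) \<le> norm z0 + 2" "norm (z0 + axis i t) \<le> norm z0 + 2"
        using norm_triangle_ineq[of z "axis i t"] norm_triangle_ineq[of z0 "axis i t"]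
          norm_triangle_ineq2[of z z0] z that by (auto simp: norm_axis dist_norm)
      then show ?thesis using D[of "z + axis i t" "z0 + axis i t"] z by (auto simp: dist_norm)
    qed
    from cpartial_diff_bound[OF F zero_less_one this]
    show "dist (cpartial i F z) (cpartial i F z0) < e" using \<open>0 < e\<close> by (simp add: dist_norm)
  qed (use d in auto)
qed

text \<open>As a function of the \<open>j\<close>-th variable the partial derivative is a locally
  uniform limit of difference quotients in direction \<open>i\<close>, each of them holomorphic in
  that variable. The case \<open>i = j\<close> needs no special treatment.\<close>

lemma separately_entire_cpartial:
  fixes F :: "complex^'n::finite \<Rightarrow> complex"
  assumes F: "separately_entire F"
  shows "separately_entire (cpartial i F)"
  unfolding separately_entire_def
proof (intro conjI allI continuous_on_cpartial F)
  fix j and z :: "complex^'n"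
  define h where "h n = inverse (real (Suc n))" for n
  have h: "0 < h n" "h n \<le> 1" for n by (auto simp: h_def field_simps)
  let ?f = "\<lambda>n t. (F ((z + axis i (of_real (h n))) + axis j t) - F (z + axis j t)) / of_real (h n)"
  show "(\<lambda>t. cpartial i F (z + axis j t)) holomorphic_on UNIV"
  proof (rule holomorphic_uniform_sequence[where f = ?f])
    fix n
    show "?f n holomorphic_on UNIV"
      using F h(1)[of n] unfolding separately_entire_def by (intro holomorphic_intros) auto
  next
    fix x :: complex
    have "uniform_limit (cball x 1) ?f (\<lambda>t. cpartial i F (z + axis j t)) sequentially"
    proof (rule uniform_limitI)
      fix e :: real assume "0 < e"
      then have e: "0 < e / 2" by simp
      \<comment> \<open>One unit for \<open>t\<close> ranging over \<open>cball x 1\<close>, one for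
        the increments, which have size at most \<open>h n \<le> 1\<close>.\<close>
      define R where "R = norm z + norm x + 2"
      obtain d where d: "0 < d" and D: "\<And>y y'. norm y \<le> R \<Longrightarrow> norm y' \<le> R \<Longrightarrow>
          norm (y - y') < d \<Longrightarrow> norm (cpartial i F y - cpartial i F y') < e / 2"
        using uniformly_near_on_cball[OF continuous_on_cpartial[OF F] e] by blast
      have "\<forall>\<^sub>F n in sequentially. h n < d"
        using d unfolding h_def by (intro order_tendstoD[OF LIMSEQ_inverse_real_of_nat])
      then show "\<forall>\<^sub>F n in sequentially. \<forall>t\<in>cball x 1. dist (?f n t) (cpartial i F (z + axis j t)) < e"
      proof eventually_elim
        case (elim n)
        show ?case
        proof
          fix t assume t: "t \<in> cball x 1"
          define y where "y = z + axis j t"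
          have "norm t \<le> norm x + 1" using t norm_triangle_ineq2[of t x] by (simp add: dist_norm norm_minus_commute)
          then have y: "norm y \<le> R - 1"
            using norm_triangle_ineq[of z "axis j t"] by (simp add: y_def R_def norm_axis)
          have y': "norm (y + axis i s) \<le> R" if "norm s \<le> h n" for s
            using norm_triangle_ineq[of y "axis i s"] y h[of n] that by (simp add: norm_axis)
          let ?c = "cpartial i F y"
          \<comment> \<open>After subtraction of the linear function with slope \<open>?c\<close>
            the derivative is at most e/2 on the disc, so the difference quotient is within e/2 of
            \<open>?c\<close>, with the same \<open>n\<close> for all \<open>t\<close>.\<close>
          have "norm ((F (y + axis i (of_real (h n))) - of_real (h n) * ?c) - (F (y + axis i 0) - 0 * ?c))
              \<le> (e / 2) * norm (of_real (h n) - (0 :: complex))"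
          proof (rule field_differentiable_bound[of "cball 0 (h n)"])
            fix s :: complex assume s: "s \<in> cball 0 (h n)"
            show "((\<lambda>s. F (y + axis i s) - s * ?c) has_field_derivative
                (cpartial i F (y + axis i s) - ?c)) (at s within cball 0 (h n))"
              by (auto intro!: derivative_eq_intros has_field_derivative_at_within[OF separately_entire_field_derivative[OF F]])
            show "norm (cpartial i F (y + axis i s) - ?c) \<le> e / 2"
              using D[OF y'[of s], of y] y s elim by (auto simp: norm_axis)
          qed (use h[of n] in auto)
          moreover have "axis i 0 = (0 :: complex^'n)" by simp
          ultimately have "norm (F (y + axis i (of_real (h n))) - F y - of_real (h n) * ?c) \<le> (e / 2) * h n"
            using h(1)[of n] by (simp add: algebra_simps)
          moreover have eq: "(z + axis i (of_real (h n))) + axis j t = y + axis i (of_real (h n))"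
            by (simp add: y_def add_ac)
          then have "?f n t - ?c = (F (y + axis i (of_real (h n))) - F y - of_real (h n) * ?c) / of_real (h n)"
            unfolding eq using h(1)[of n] by (simp add: diff_divide_distrib flip: y_def)
          ultimately have "norm (?f n t - ?c) \<le> e / 2"
            using h(1)[of n] by (simp add: norm_divide divide_le_eq)
          then show "dist (?f n t) (cpartial i F (z + axis j t)) < e"
            using \<open>0 < e\<close> by (simp add: dist_norm y_def)
        qed
      qed
    qed
    then show "\<exists>d>0. cball x d \<subseteq> UNIV \<and>
        uniform_limit (cball x d) ?f (\<lambda>t. cpartial i F (z + axis j t)) sequentially"
      by (intro exI[of _ 1]) auto
  qed auto
qed

lemma separately_entire_iter_cpartial: "separately_entire F \<Longrightarrow> separately_entire (iter_cpartial js F)"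
  by (induction js) (auto intro: separately_entire_cpartial)

text \<open>Applying the first-order estimate \<open>k\<close> times costs \<open>k\<^sup>k\<close> rather than \<open>k!\<close>, a geometric loss, but
  it needs no grouping of the differentiations by direction.\<close>

lemma iter_cpartial_bound:
  fixes F :: "complex^'n::finite \<Rightarrow> complex"
  assumes F: "separately_entire F" and r: "0 < r"
    and B: "\<And>z'. norm (z' - z) \<le> real (length js) * r \<Longrightarrow> norm (F z') \<le> B"
  shows "norm (iter_cpartial js F z) \<le> B / r ^ length js"
  using B
proof (induction js arbitrary: z)
  case (Cons i js)
  have "norm (cpartial i (iter_cpartial js F) z) \<le> (B / r ^ length js) / r"
  proof (rule cpartial_bound[OF separately_entire_iter_cpartial[OF F] r])
    fix t :: complex assume t: "norm t = r"
    show "norm (iter_cpartial js F (z + axis i t)) \<le> B / r ^ length js"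
    proof (rule Cons.IH, rule Cons.prems)
      fix z' assume "norm (z' - (z + axis i t)) \<le> real (length js) * r"
      then show "norm (z' - z) \<le> real (length (i # js)) * r"
        using norm_triangle_ineq[of "z' - (z + axis i t)" "axis i t"] t
        by (simp add: norm_axis algebra_simps)
    qed
  qed
  then show ?case by (simp add: mult.commute)
qed simp

text \<open>The complex-linearity required in \<open>entire\<close> makes the Frechet derivative
  along axis \<open>i\<close> a multiplication by the number \<open>F' (axis i 1)\<close>, that is,
  a complex derivative.\<close>

lemma entire_imp_separately_entire:
  fixes F :: "complex^'n::finite \<Rightarrow> complex"
  assumes "entire F"
  shows "separately_entire F"
  unfolding separately_entire_def
proof (intro conjI allI)
  show "continuous_on UNIV F"
    using assms unfolding entire_def
    by (meson continuous_at_imp_continuous_on has_derivative_continuous)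
  fix i and z :: "complex^'n"
  have "(\<lambda>t. F (z + axis i t)) field_differentiable (at t)" for t
  proof -
    obtain F' where F': "(F has_derivative F') (at (z + axis i t))" and lin: "\<And>c v. F' (c *s v) = c * F' v"
      using assms unfolding entire_def by meson
    have "((\<lambda>t. z + axis i t) has_derivative axis i) (at t)"
      by (auto intro!: derivative_eq_intros bounded_linear.has_derivative[OF bounded_linear_axis])
    from has_derivative_compose[OF this F']
    have "((\<lambda>t. F (z + axis i t)) has_derivative (\<lambda>s. F' (axis i s))) (at t)" .
    moreover have "(\<lambda>s. F' (axis i s)) = (*) (F' (axis i 1))"
    proof
      fix s
      have "axis i s = s *s (axis i 1 :: complex^'n)" by (simp add: vec_eq_iff axis_def)
      then show "F' (axis i s) = F' (axis i 1) * s" by (metis lin mult.commute)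
    qed
    ultimately have "((\<lambda>t. F (z + axis i t)) has_derivative (*) (F' (axis i 1))) (at t)"
      by simp
    then show ?thesis by (auto simp: field_differentiable_def has_field_derivative_def)
  qed
  then show "(\<lambda>t. F (z + axis i t)) holomorphic_on UNIV"
    by (simp add: holomorphic_on_def field_differentiable_at_within)
qed

text \<open>The one-variable identity theorem is applied to one coordinate after another;
  \<open>S\<close> holds the coordinates that may already be non-real.\<close>

lemma separately_entire_eq_0:
  fixes F :: "complex^'n::finite \<Rightarrow> complex"
  assumes F: "separately_entire F" and real: "\<And>x. F (complexify x) = 0"
  shows "F z = 0"
proof -
  have "F z = 0" if "finite S" "\<And>i. i \<notin> S \<Longrightarrow> z $ i \<in> \<real>" for S and z :: "complex^'n"
    using that
  proof (induction S arbitrary: z)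
    case empty
    then have "z = complexify (\<chi> i. Re (z $ i))"
      by (simp add: complexify_def vec_eq_iff)
    then show ?case using real by metis
  next
    case (insert i S)
    have hol: "(\<lambda>t. F (z + axis i t)) holomorphic_on UNIV"
      using F by (simp add: separately_entire_def)
    \<comment> \<open>The shifts that make coordinate \<open>i\<close> real form a line on which the
      induction hypothesis gives zero. Since the line has a limit point, the slice vanishes
      everywhere, in particular at shift 0, which recovers \<open>z\<close>.\<close>
    let ?U = "{t. z $ i + t \<in> \<real>}"
    have lim: "(0 - z $ i) islimpt ?U"
      unfolding islimpt_approachable
    proof (intro allI impI)
      fix e :: real assume "0 < e"
      then show "\<exists>t\<in>?U. t \<noteq> 0 - z $ i \<and> dist t (0 - z $ i) < e"
        by (intro bexI[of _ "of_real (e / 2) - z $ i"]) (auto simp: dist_norm)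
    qed
    have zero: "F (z + axis i t) = 0" if "t \<in> ?U" for t
      using that insert.prems by (intro insert.IH) (auto simp: axis_def)
    have "F (z + axis i 0) = 0"
      by (rule analytic_continuation[OF hol open_UNIV connected_UNIV subset_UNIV UNIV_I lim zero UNIV_I])
    then show ?case by simp
  qed
  from this[of UNIV] show ?thesis by simp
qed

section \<open>Restriction to the real subspace\<close>

lemma complexify_plus_axis: "complexify (x + t *\<^sub>R axis i 1) = complexify x + axis i (of_real t)"
  by (simp add: complexify_def vec_eq_iff axis_def)

lemma continuous_on_complexify: "continuous_on S complexify"
  unfolding complexify_def by (intro continuous_intros)

lemma separately_entire_partial_deriv:
  assumes F: "separately_entire F"
  shows "((\<lambda>t. F (complexify (x + t *\<^sub>R axis i 1))) has_vector_derivative cpartial i F (complexify x)) (at 0)"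
    "partial_deriv i (\<lambda>x. F (complexify x)) = (\<lambda>x. cpartial i F (complexify x))"
proof -
  show *: "((\<lambda>t. F (complexify (x + t *\<^sub>R axis i 1))) has_vector_derivative cpartial i F (complexify x)) (at 0)" for x
    using has_vector_derivative_real_field[of "\<lambda>t. F (complexify x + axis i t)" "cpartial i F (complexify x)" 0 UNIV]
      separately_entire_field_derivative[OF F, of "complexify x" i 0]
    by (simp add: complexify_plus_axis)
  then show "partial_deriv i (\<lambda>x. F (complexify x)) = (\<lambda>x. cpartial i F (complexify x))"
    unfolding partial_deriv_def by (intro ext vector_derivative_at)
qed

text \<open>Restriction intertwines complex and real partial derivatives, so Cauchy estimates for
  \<open>iter_cpartial\<close> bound the derivatives that enter \<open>p_norm\<close>.\<close>

lemma iter_partial_complexify: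
  assumes "separately_entire F"
  shows "iter_partial js (\<lambda>x. F (complexify x)) = (\<lambda>x. iter_cpartial js F (complexify x))"
  by (induction js) (auto simp: separately_entire_partial_deriv separately_entire_iter_cpartial assms)

lemma smooth_complexify:
  assumes "separately_entire F"
  shows "smooth (\<lambda>x. F (complexify x))"
proof -
  have "continuous_on UNIV (\<lambda>x. iter_cpartial js F (complexify x))" for js
    using separately_entire_iter_cpartial[OF assms, of js]
    by (auto simp: separately_entire_def intro: continuous_on_compose2[OF _ continuous_on_complexify])
  moreover have "(\<lambda>t. iter_cpartial js F (complexify (x + t *\<^sub>R axis i 1))) differentiable (at 0)" for js x i
    using separately_entire_partial_deriv(1)[OF separately_entire_iter_cpartial[OF assms, of js]]
    by (auto simp: differentiable_def has_vector_derivative_def)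
  ultimately show ?thesis by (simp add: smooth_def iter_partial_complexify assms)
qed

section \<open>Taylor series\<close>

text \<open>Sums over multi-indices of order \<open>k\<close> with weights \<open>1 / \<alpha>!\<close> are written as sums over all index
  lists of length \<open>k\<close> with the single weight \<open>1 / k!\<close>: a multi-index \<open>\<alpha>\<close> arises from \<open>k! / \<alpha>!\<close> lists.\<close>

primrec list_monom :: "'n::finite list \<Rightarrow> complex^'n \<Rightarrow> complex" where
  "list_monom [] z = 1"
| "list_monom (i # is) z = z $ i * list_monom is z"

primrec list_monom_deriv :: "'n::finite list \<Rightarrow> complex^'n \<Rightarrow> complex^'n \<Rightarrow> complex" where
  "list_monom_deriv [] z v = 0"
| "list_monom_deriv (i # is) z v = z $ i * list_monom_deriv is z v + v $ i * list_monom is z"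

definition hpoly :: "('n::finite list \<Rightarrow> complex) \<Rightarrow> nat \<Rightarrow> complex^'n \<Rightarrow> complex" where
  "hpoly c k z = (\<Sum>is | length is = k. c is * list_monom is z) / fact k"

definition hpoly_deriv :: "('n::finite list \<Rightarrow> complex) \<Rightarrow> nat \<Rightarrow> complex^'n \<Rightarrow> complex^'n \<Rightarrow> complex" where
  "hpoly_deriv c k z v = (\<Sum>is | length is = k. c is * list_monom_deriv is z v) / fact k"

definition taylor_series :: "('n::finite list \<Rightarrow> complex) \<Rightarrow> complex^'n \<Rightarrow> complex" where
  "taylor_series c z = (\<Sum>k. hpoly c k z)"

text \<open>The factorial cancels against the one in \<open>hpoly\<close>, and the arbitrary \<eta>
  beats every dilation of the argument; hence the Taylor series converges on all of complex
  space.\<close>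

definition infra_exponential :: "('n::finite list \<Rightarrow> complex) \<Rightarrow> bool" where
  "infra_exponential c \<longleftrightarrow> (\<forall>\<eta>>0. \<exists>C. \<forall>is. norm (c is) \<le> C * \<eta> ^ length is * fact (length is))"

lemma finite_lists_length [simp]: "finite {is :: 'n::finite list. length is = k}"
  using finite_lists_length_eq[of "UNIV :: 'n set" k] by simp

lemma card_lists_length: "card {is :: 'n::finite list. length is = k} = CARD('n) ^ k"
  using card_lists_length_eq[of "UNIV :: 'n set" k] by simp

lemma sum_lists_length_Suc:
  "(\<Sum>is | length is = Suc k. g is) = (\<Sum>is | length is = k. \<Sum>i\<in>UNIV. g (i # is :: 'n::finite list))"
proof -
  have "{is :: 'n list. length is = Suc k} = (\<lambda>(is, i). i # is) ` ({is. length is = k} \<times> UNIV)"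
    by (auto simp: length_Suc_conv image_iff)
  moreover have "inj_on (\<lambda>(is, i). i # is) ({is :: 'n list. length is = k} \<times> UNIV)"
    by (auto simp: inj_on_def)
  ultimately show ?thesis
    by (simp add: sum.reindex sum.cartesian_product case_prod_unfold)
qed

lemma has_derivative_list_monom: "(list_monom is has_derivative list_monom_deriv is z) (at z)"
proof (induction "is")
  case (Cons i "is")
  have "((\<lambda>z. z $ i) has_derivative (\<lambda>v. v $ i)) (at z)"
    by (rule bounded_linear.has_derivative[OF bounded_linear_vec_nth has_derivative_ident])
  from has_derivative_mult[OF this Cons.IH] show ?case by simp
qed simp

lemma has_derivative_hpoly: "(hpoly c k has_derivative hpoly_deriv c k z) (at z)"
  unfolding hpoly_def hpoly_deriv_def
  by (intro bounded_linear.has_derivative[OF bounded_linear_divide] has_derivative_sum has_derivative_mult_right has_derivative_list_monom)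

lemma norm_list_monom: "norm (list_monom is z) \<le> norm z ^ length is"
  by (induction "is") (auto simp: norm_mult intro!: mult_mono Finite_Cartesian_Product.norm_nth_le)

text \<open>The natural exponent is one lower; with \<open>1 \<le> R\<close> the full exponent is
  admissible and no subtraction on naturals arises.\<close>

lemma norm_list_monom_deriv:
  assumes "norm z \<le> R" "1 \<le> R"
  shows "norm (list_monom_deriv is z v) \<le> real (length is) * R ^ length is * norm v"
proof (induction "is")
  case (Cons i "is")
  have "norm (z $ i * list_monom_deriv is z v) \<le> R * (real (length is) * R ^ length is * norm v)"
    unfolding norm_mult using Cons assms Finite_Cartesian_Product.norm_nth_le[of z i] by (intro mult_mono) auto
  moreover have "norm (v $ i * list_monom is z) \<le> norm v * R ^ length (i # is)"
  proof -
    have "norm (list_monom is z) \<le> R ^ length is"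
      using norm_list_monom[of "is" z] power_mono[of "norm z" R "length is"] assms by simp
    also have "\<dots> \<le> R ^ length (i # is)" using assms(2) by (intro power_increasing) auto
    finally show ?thesis
      unfolding norm_mult using Finite_Cartesian_Product.norm_nth_le[of v i] by (intro mult_mono) auto
  qed
  ultimately show ?case
    using norm_triangle_ineq[of "z $ i * list_monom_deriv is z v" "v $ i * list_monom is z"]
    by (simp add: algebra_simps)
qed simp

text \<open>There are \<open>CARD('n) ^ k\<close> index lists of length \<open>k\<close>, so the
  crude bound of each summand dilates the norm of \<open>z\<close> by the dimension only, a
  geometric loss.\<close>

lemma norm_hpoly:
  fixes c :: "'n::finite list \<Rightarrow> complex"
  assumes "\<And>is. length is = k \<Longrightarrow> norm (c is) \<le> B"
  shows "norm (hpoly c k z) \<le> B * (real CARD('n) * norm z) ^ k / fact k"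
proof -
  have "norm (\<Sum>is | length is = k. c is * list_monom is z)
      \<le> (\<Sum>is :: 'n list | length is = k. B * norm z ^ k)"
    using assms norm_list_monom[of _ z]
    by (intro sum_norm_le) (fastforce simp: norm_mult intro!: mult_mono order_trans[OF norm_ge_zero])
  also have "\<dots> = B * (real CARD('n) * norm z) ^ k"
    by (simp add: card_lists_length power_mult_distrib)
  finally show ?thesis by (simp add: hpoly_def norm_divide divide_right_mono)
qed

lemma norm_hpoly_deriv:
  fixes c :: "'n::finite list \<Rightarrow> complex"
  assumes "\<And>is. length is = k \<Longrightarrow> norm (c is) \<le> B" "norm z \<le> R" "1 \<le> R"
  shows "norm (hpoly_deriv c k z v) \<le> B * real k * (real CARD('n) * R) ^ k / fact k * norm v"
proof -
  have "norm (\<Sum>is | length is = k. c is * list_monom_deriv is z v)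
      \<le> (\<Sum>is :: 'n list | length is = k. B * (real k * R ^ k * norm v))"
    using assms norm_list_monom_deriv[OF assms(2,3), of _ v]
    by (intro sum_norm_le) (fastforce simp: norm_mult intro!: mult_mono order_trans[OF norm_ge_zero])
  also have "\<dots> = B * real k * (real CARD('n) * R) ^ k * norm v"
    by (simp add: card_lists_length power_mult_distrib)
  finally show ?thesis by (simp add: hpoly_deriv_def norm_divide divide_right_mono)
qed

lemma list_monom_deriv_scale: "list_monom_deriv is z (a *s v) = a * list_monom_deriv is z v"
  by (induction "is") (auto simp: algebra_simps)

lemma hpoly_deriv_scale: "hpoly_deriv c k z (a *s v) = a * hpoly_deriv c k z v"
  by (simp add: hpoly_deriv_def list_monom_deriv_scale sum_distrib_left mult_ac)

lemma infra_exponential_bounds: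
  fixes c :: "'n::finite list \<Rightarrow> complex"
  assumes c: "infra_exponential c" and R: "1 \<le> R"
  obtains C where
    "\<And>k z. norm z \<le> R \<Longrightarrow> norm (hpoly c k z) \<le> C * (1/2) ^ k"
    "\<And>k z v. norm z \<le> R \<Longrightarrow> norm (hpoly_deriv c k z v) \<le> C * (real k * (1/2) ^ k) * norm v"
proof -
  \<comment> \<open>Chosen so that \<eta> times the dilation \<open>CARD('n) * R\<close> is
    1/2.\<close>
  define \<eta> where "\<eta> = 1 / (2 * (real CARD('n) * R))"
  have nR: "0 < real CARD('n) * R" using R by simp
  then have "0 < \<eta>" by (simp add: \<eta>_def)
  then obtain C where C: "\<And>is. norm (c is) \<le> C * \<eta> ^ length is * fact (length is)"
    using c unfolding infra_exponential_def by blast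
  have "0 \<le> C" using order_trans[OF norm_ge_zero C[of "[]"]] by simp
  have half: "\<eta> ^ k * (real CARD('n) * R) ^ k = (1/2) ^ k" for k
  proof -
    have "\<eta> * X = 1/2" if "\<eta> = 1 / (2 * X)" "0 < X" for X :: real
      using that by simp
    from this[OF \<eta>_def nR] show ?thesis by (simp only: power_mult_distrib[symmetric])
  qed
  show ?thesis
  proof (rule that)
    fix k :: nat and z v :: "complex^'n" assume z: "norm z \<le> R"
    have "norm (hpoly c k z) \<le> (C * \<eta> ^ k * fact k) * (real CARD('n) * norm z) ^ k / fact k"
      using C by (intro norm_hpoly) auto
    also have "\<dots> = C * \<eta> ^ k * (real CARD('n) * norm z) ^ k" by simp
    also have "\<dots> \<le> C * \<eta> ^ k * (real CARD('n) * R) ^ k"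
      using z \<open>0 \<le> C\<close> \<open>0 < \<eta>\<close> by (intro mult_left_mono power_mono) auto
    finally show "norm (hpoly c k z) \<le> C * (1/2) ^ k" by (simp only: mult.assoc half)
    have "norm (hpoly_deriv c k z v)
        \<le> (C * \<eta> ^ k * fact k) * real k * (real CARD('n) * R) ^ k / fact k * norm v"
      using C z R by (intro norm_hpoly_deriv) auto
    also have "\<dots> = C * (real k * (\<eta> ^ k * (real CARD('n) * R) ^ k)) * norm v" by simp
    finally show "norm (hpoly_deriv c k z v) \<le> C * (real k * (1/2) ^ k) * norm v"
      unfolding half .
  qed
qed

lemma summable_nat_half: "summable (\<lambda>k. real k * (1/2) ^ k)"
\<comment> \<open>Consecutive terms have ratio (k + 1) / (2 k), which is at most 3/4 from k = 2
  on.\<close>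
proof (rule summable_ratio_test[where c = "3/4" and N = 2])
  fix k :: nat assume "2 \<le> k"
  then show "norm (real (Suc k) * (1/2) ^ Suc k) \<le> 3/4 * norm (real k * (1/2) ^ k)"
    by (simp add: field_simps)
qed simp

lemma taylor_series_sums:
  assumes c: "infra_exponential c"
  shows "(\<lambda>k. hpoly c k z) sums taylor_series c z"
proof -
  obtain C where C: "\<And>k. norm (hpoly c k z) \<le> C * (1/2) ^ k"
    using infra_exponential_bounds[OF c, of "1 + norm z"] by (metis add.commute le_add_same_cancel1 le_add_same_cancel2 norm_ge_zero zero_le_one)
  have "summable (\<lambda>k. C * (1/2 :: real) ^ k)" by (intro summable_mult summable_geometric) simp
  then have "summable (\<lambda>k. hpoly c k z)"
    by (rule summable_comparison_test'[where N = 0]) (rule C)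
  then show ?thesis by (simp add: taylor_series_def summable_sums)
qed

text \<open>The series may be differentiated term by term: near \<open>z0\<close> the derivatives of
  the homogeneous parts are dominated by one summable series times \<open>norm v\<close>, uniformly
  in the point, and complex-linearity survives summation.\<close>

lemma entire_taylor_series:
  fixes c :: "'n::finite list \<Rightarrow> complex"
  assumes c: "infra_exponential c"
  shows "entire (taylor_series c)"
  unfolding entire_def
proof (intro allI)
  fix z0 :: "complex^'n"
  define R where "R = norm z0 + 1"
  have R: "1 \<le> R" by (simp add: R_def)
  obtain C where C: "\<And>k z v. norm z \<le> R \<Longrightarrow>
      norm (hpoly_deriv c k z v) \<le> C * (real k * (1/2) ^ k) * norm v"
    using infra_exponential_bounds[OF c R] by metis
  let ?b = "\<lambda>k. C * (real k * (1/2) ^ k)"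
  have b: "summable ?b" by (intro summable_mult summable_nat_half)
  have sd: "summable (\<lambda>k. hpoly_deriv c k z v)" if "norm z \<le> R" for z v
    by (rule summable_comparison_test'[OF summable_mult2[OF b], where N = 0]) (rule C[OF that])
  have "\<exists>g. \<forall>z\<in>ball 0 R. (\<lambda>k. hpoly c k z) sums g z \<and>
      (g has_derivative (\<lambda>v. \<Sum>k. hpoly_deriv c k z v)) (at z within ball 0 R)"
  proof (rule has_derivative_series[OF convex_ball])
    show "(hpoly c k has_derivative hpoly_deriv c k z) (at z within ball 0 R)" for k z
      by (rule has_derivative_at_withinI[OF has_derivative_hpoly])
    show "0 \<in> ball (0 :: complex^'n) R" using R by simp
    show "(\<lambda>k. hpoly c k 0) sums taylor_series c 0" by (rule taylor_series_sums[OF c])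
  next
    fix e :: real assume "0 < e"
    from suminf_exist_split[OF this b] obtain N where
      N: "\<And>n. n \<ge> N \<Longrightarrow> norm (\<Sum>k. ?b (k + n)) < e" by blast
    have "norm ((\<Sum>k<n. hpoly_deriv c k z v) - (\<Sum>k. hpoly_deriv c k z v)) \<le> e * norm v"
      if n: "n \<ge> N" and z: "norm z \<le> R" for n z v
    proof -
      have sh: "summable (\<lambda>k. ?b (k + n))" using b by (subst summable_iff_shift)
      have "norm ((\<Sum>k<n. hpoly_deriv c k z v) - (\<Sum>k. hpoly_deriv c k z v))
          = norm (\<Sum>k. hpoly_deriv c (k + n) z v)"
        using suminf_split_initial_segment[OF sd[OF z, of v], of n] by (simp add: norm_minus_commute)
      also have "\<dots> \<le> (\<Sum>k. ?b (k + n) * norm v)"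
        by (intro norm_suminf_le summable_mult2[OF sh] C[OF z])
      also have "\<dots> = (\<Sum>k. ?b (k + n)) * norm v" by (rule suminf_mult2[OF sh, symmetric])
      also have "\<dots> \<le> e * norm v" using N[OF n] by (intro mult_right_mono) auto
      finally show ?thesis .
    qed
    then show "\<forall>\<^sub>F n in sequentially. \<forall>z\<in>ball 0 R. \<forall>v.
        norm ((\<Sum>k<n. hpoly_deriv c k z v) - (\<Sum>k. hpoly_deriv c k z v)) \<le> e * norm v"
      unfolding eventually_sequentially by (intro exI[of _ N]) auto
  qed
  then obtain g where g: "\<And>z. z \<in> ball 0 R \<Longrightarrow> (\<lambda>k. hpoly c k z) sums g z"
    "\<And>z. z \<in> ball 0 R \<Longrightarrow> (g has_derivative (\<lambda>v. \<Sum>k. hpoly_deriv c k z v)) (at z within ball 0 R)"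
    by metis
  have z0: "z0 \<in> ball 0 R" by (simp add: R_def)
  have "(g has_derivative (\<lambda>v. \<Sum>k. hpoly_deriv c k z0 v)) (at z0)"
    using g(2)[OF z0] unfolding at_within_open[OF z0 open_ball] .
  then have "(taylor_series c has_derivative (\<lambda>v. \<Sum>k. hpoly_deriv c k z0 v)) (at z0)"
    by (rule has_derivative_transform_within_open[OF _ open_ball z0])
      (rule sums_unique2[OF g(1) taylor_series_sums[OF c]])
  moreover have "(\<Sum>k. hpoly_deriv c k z0 (a *s v)) = a * (\<Sum>k. hpoly_deriv c k z0 v)" for a v
    using suminf_mult[OF sd[of z0 v], of a] by (simp add: hpoly_deriv_scale R_def)
  ultimately show "\<exists>F'. (taylor_series c has_derivative F') (at z0) \<and> (\<forall>a v. F' (a *s v) = a * F' v)"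
    by (intro exI[of _ "\<lambda>v. \<Sum>k. hpoly_deriv c k z0 v"]) auto
qed

text \<open>\<open>fact k * hpoly\<close> is the \<open>k\<close>-th derivative of \<open>f\<close>
  along the line. Differentiating once more prepends an arbitrary index to every list, so the sum
  over lists passes to length k + 1 without any multinomial coefficient.\<close>

lemma hpoly_along_line:
  fixes f :: "real^'n::finite \<Rightarrow> complex"
  assumes f: "smooth f"
  shows "((\<lambda>t. fact k * hpoly (\<lambda>is. iter_partial is f (x + t *\<^sub>R v)) k (complexify v)) has_vector_derivative
     fact (Suc k) * hpoly (\<lambda>is. iter_partial is f (x + t *\<^sub>R v)) (Suc k) (complexify v)) (at t)"
proof -
  have "((\<lambda>t. \<Sum>is | length is = k. iter_partial is f (x + t *\<^sub>R v) * list_monom is (complexify v))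
      has_vector_derivative (\<Sum>is | length is = k. (\<Sum>i\<in>UNIV. v $ i *\<^sub>R iter_partial (i # is) f (x + t *\<^sub>R v))
        * list_monom is (complexify v))) (at t)"
    using smooth_along_line[OF smooth_iter_partial[OF f]]
    by (intro has_vector_derivative_sum has_vector_derivative_mult_left) auto
  moreover have "(\<Sum>is | length is = k. (\<Sum>i\<in>UNIV. v $ i *\<^sub>R iter_partial (i # is) f (x + t *\<^sub>R v))
        * list_monom is (complexify v))
      = (\<Sum>is | length is = Suc k. iter_partial is f (x + t *\<^sub>R v) * list_monom is (complexify v))"
    unfolding sum_lists_length_Suc
    by (simp add: complexify_def sum_distrib_left sum_distrib_right scaleR_conv_of_real mult_ac)
  ultimately show ?thesis by (simp add: hpoly_def del: fact_Suc)
qed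

text \<open>The hypothesis \<open>B\<close> holds with arbitrarily small \<eta> on a ball containing
  the points \<open>x + t v\<close> with |t| at most 1, so the Lagrange remainder of order n is at
  most C (1/2)^n.\<close>

lemma taylor_series_eq:
  fixes f :: "real^'n::finite \<Rightarrow> complex"
  assumes f: "smooth f"
    and B: "\<And>R \<eta>. 0 < R \<Longrightarrow> 0 < \<eta> \<Longrightarrow> \<exists>C. \<forall>y. norm y \<le> R \<longrightarrow>
      (\<forall>is. norm (iter_partial is f y) \<le> C * \<eta> ^ length is * fact (length is))"
  shows "taylor_series (\<lambda>is. iter_partial is f x) (complexify v) = f (x + v)"
proof -
  let ?D = "\<lambda>k t. fact k * hpoly (\<lambda>is. iter_partial is f (x + t *\<^sub>R v)) k (complexify v)"
  define R where "R = norm x + norm v + 1"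
  \<comment> \<open>The added 1 keeps \<open>V\<close> positive when \<open>v\<close> is zero, so
    that \<eta> is well chosen.\<close>
  define V where "V = real CARD('n) * (norm (complexify v) + 1)"
  define \<eta> where "\<eta> = 1 / (2 * V)"
  have V: "V > 0" by (auto simp: V_def intro!: mult_pos_pos add_nonneg_pos)
  then have \<eta>: "\<eta> > 0" by (simp add: \<eta>_def)
  have "0 < R" using norm_ge_zero[of x] norm_ge_zero[of v] unfolding R_def by linarith
  from B[OF this \<eta>] obtain C where
    C: "\<And>y is. norm y \<le> R \<Longrightarrow> norm (iter_partial is f y) \<le> C * \<eta> ^ length is * fact (length is)"
    by blast
  have "0 \<le> C" using order_trans[OF norm_ge_zero C[of 0 "[]"]] \<open>0 < R\<close> by simp
  have D: "norm (?D k t / fact k) \<le> C * (1/2) ^ k" if "\<bar>t\<bar> \<le> 1" for k t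
  proof -
    have "norm (t *\<^sub>R v) \<le> norm v" using that by (simp add: mult_left_le_one_le)
    then have y: "norm (x + t *\<^sub>R v) \<le> R" using norm_triangle_ineq[of x "t *\<^sub>R v"] by (simp add: R_def)
    have "norm (?D k t / fact k) = norm (hpoly (\<lambda>is. iter_partial is f (x + t *\<^sub>R v)) k (complexify v))"
      by simp
    also have "\<dots> \<le> (C * \<eta> ^ k * fact k) * (real CARD('n) * norm (complexify v)) ^ k / fact k"
      using C[OF y] by (intro norm_hpoly) auto
    also have "\<dots> = C * \<eta> ^ k * (real CARD('n) * norm (complexify v)) ^ k" by simp
    also have "\<dots> \<le> C * \<eta> ^ k * V ^ k"
      using \<open>0 \<le> C\<close> \<eta> by (intro mult_left_mono power_mono) (auto simp: V_def)
    also have "\<dots> = C * (1/2) ^ k"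
    proof -
      have "\<eta> * V = 1/2" using V by (simp add: \<eta>_def)
      then show ?thesis by (simp only: mult.assoc power_mult_distrib[symmetric])
    qed
    finally show ?thesis .
  qed
  let ?h = "\<lambda>k. hpoly (\<lambda>is. iter_partial is f x) k (complexify v)"
  \<comment> \<open>The Lagrange form of the remainder exists for real-valued functions only, so it
    is applied to a real functional \<open>L\<close>, later taken to be \<open>Re\<close> and
    \<open>Im\<close>; the intermediate point may differ between the two.\<close>
  have lim: "(\<lambda>n. \<Sum>k<n. L (?h k)) \<longlonglongrightarrow> L (f (x + v))"
    if L: "bounded_linear L" and L1: "\<And>u. \<bar>L u\<bar> \<le> norm u" for L :: "complex \<Rightarrow> real"
  proof -
    have rem: "norm (L (f (x + v)) - (\<Sum>k<n. L (?D k 0) / fact k)) \<le> C * (1/2) ^ n" for n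
    proof -
      have "\<exists>t. \<bar>t\<bar> \<le> \<bar>1\<bar> \<and> L (f (x + 1 *\<^sub>R v)) = (\<Sum>k<n. L (?D k 0) / fact k * 1 ^ k) + L (?D n t) / fact n * 1 ^ n"
      proof (rule Maclaurin_all_le[where f = "\<lambda>t. L (f (x + t *\<^sub>R v))" and diff = "\<lambda>k t. L (?D k t)"])
        show "(\<lambda>t. L (?D 0 t)) = (\<lambda>t. L (f (x + t *\<^sub>R v)))"
          by (simp add: hpoly_def)
        show "\<forall>k t. ((\<lambda>t. L (?D k t)) has_real_derivative L (?D (Suc k) t)) (at t)"
          unfolding has_real_derivative_iff_has_vector_derivative
          by (intro allI bounded_linear.has_vector_derivative[OF L hpoly_along_line[OF f]])
      qed
      then obtain t where t: "\<bar>t\<bar> \<le> 1" and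
        eq: "L (f (x + v)) - (\<Sum>k<n. L (?D k 0) / fact k) = L (?D n t) / fact n"
        by auto
      have "\<bar>L (?D n t)\<bar> / fact n \<le> norm (?D n t) / fact n"
        by (rule divide_right_mono[OF L1]) simp
      then have "\<bar>L (?D n t) / fact n\<bar> \<le> norm (?D n t / fact n)"
        by (simp only: norm_divide norm_fact abs_divide abs_of_pos[OF fact_gt_zero])
      then show ?thesis using D[OF t, of n] eq by simp
    qed
    have null: "(\<lambda>n. C * (1/2) ^ n) \<longlonglongrightarrow> 0"
      by (intro tendsto_mult_right_zero LIMSEQ_power_zero) auto
    have "(\<lambda>n. L (f (x + v)) - (\<Sum>k<n. L (?D k 0) / fact k)) \<longlonglongrightarrow> 0"
      by (rule Lim_null_comparison[OF always_eventually null]) (rule allI[OF rem])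
    from tendsto_diff[OF tendsto_const[of "L (f (x + v))"] this]
    have "(\<lambda>n. \<Sum>k<n. L (?D k 0) / fact k) \<longlonglongrightarrow> L (f (x + v))" by simp
    moreover have "L (?D k 0) / fact k = L (?h k)" for k
    proof -
      have "?D k 0 = (fact k :: real) *\<^sub>R ?h k" by (simp add: scaleR_conv_of_real)
      then show ?thesis using linear_scale[OF bounded_linear.linear[OF L]] by simp
    qed
    ultimately show ?thesis by simp
  qed
  have "(\<lambda>n. \<Sum>k<n. Re (?h k)) \<longlonglongrightarrow> Re (f (x + v))" "(\<lambda>n. \<Sum>k<n. Im (?h k)) \<longlonglongrightarrow> Im (f (x + v))"
    by (rule lim[OF bounded_linear_Re abs_Re_le_cmod], rule lim[OF bounded_linear_Im abs_Im_le_cmod])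
  then have "?h sums f (x + v)"
    unfolding sums_def tendsto_complex_iff by simp
  then show ?thesis by (simp add: taylor_series_def sums_iff)
qed

lemma separately_entire_diff:
  assumes "separately_entire F" "separately_entire G"
  shows "separately_entire (\<lambda>z. F z - G z)"
  using assms unfolding separately_entire_def
  by (auto intro!: continuous_intros holomorphic_intros)

lemma separately_entire_translate:
  assumes "separately_entire F"
  shows "separately_entire (\<lambda>z. F (a + z))"
  using assms unfolding separately_entire_def
  by (auto simp: add.assoc[symmetric] intro!: continuous_intros intro: continuous_on_compose2)

text \<open>Both sides are entire in \<zeta>, and at a real displacement \<open>v\<close> both equal
  \<open>f (x + v)\<close>; vanishing of the difference on the real subspace then gives the claim
  without rearranging series.\<close>

lemma taylor_series_recentre:
  fixes f :: "real^'n::finite \<Rightarrow> complex"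
  assumes f: "smooth f"
    and B: "\<And>R \<eta>. 0 < R \<Longrightarrow> 0 < \<eta> \<Longrightarrow> \<exists>C. \<forall>y. norm y \<le> R \<longrightarrow>
      (\<forall>is. norm (iter_partial is f y) \<le> C * \<eta> ^ length is * fact (length is))"
  shows "taylor_series (\<lambda>is. iter_partial is f 0) (complexify x + \<zeta>) = taylor_series (\<lambda>is. iter_partial is f x) \<zeta>"
proof -
  have infra: "infra_exponential (\<lambda>is. iter_partial is f y)" for y
    unfolding infra_exponential_def
  proof (intro allI impI)
    fix \<eta> :: real assume "0 < \<eta>"
    have "0 < norm y + 1" by (simp add: add_nonneg_pos)
    from B[OF this \<open>0 < \<eta>\<close>]
    show "\<exists>C. \<forall>is. norm (iter_partial is f y) \<le> C * \<eta> ^ length is * fact (length is)"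
      by force
  qed
  let ?F = "\<lambda>y. taylor_series (\<lambda>is. iter_partial is f y)"
  have se: "separately_entire (?F y)" for y
    by (intro entire_imp_separately_entire entire_taylor_series infra)
  have "?F 0 (complexify x + \<zeta>) - ?F x \<zeta> = 0"
  proof (rule separately_entire_eq_0)
    show "separately_entire (\<lambda>\<zeta>. ?F 0 (complexify x + \<zeta>) - ?F x \<zeta>)"
      by (intro separately_entire_diff separately_entire_translate se)
    fix v
    have "complexify x + complexify v = complexify (x + v)" by (simp add: complexify_def vec_eq_iff)
    then show "?F 0 (complexify x + complexify v) - ?F x (complexify v) = 0"
      using taylor_series_eq[OF f B] by simp
  qed
  then show ?thesis by simp
qed

section \<open>Topologies given by seminorms\<close>

text \<open>Since \<open>T\<close> respects differences, a bound at the origin gives continuity at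
  every point. The assumption \<open>bound\<close> speaks of all real \<open>r\<close> instead of
  \<open>q (T f) \<le> C * p f\<close>, which avoids products of extended reals.\<close>

lemma continuous_map_seminorm_topology:
  assumes P: "P \<noteq> {}" "\<And>p. p \<in> P \<Longrightarrow> p (\<lambda>x. 0) = 0"
    and Q: "Q \<noteq> {}" "\<And>q. q \<in> Q \<Longrightarrow> q (\<lambda>x. 0) = 0"
    and triangle: "\<And>q a b c. q \<in> Q \<Longrightarrow> a \<in> W \<Longrightarrow> b \<in> W \<Longrightarrow> c \<in> W \<Longrightarrow>
      q (\<lambda>x. a x - c x) \<le> q (\<lambda>x. a x - b x) + q (\<lambda>x. b x - c x)"
    and V: "\<And>f g. f \<in> V \<Longrightarrow> g \<in> V \<Longrightarrow> (\<lambda>x. f x - g x) \<in> V"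
    and T: "\<And>f. f \<in> V \<Longrightarrow> T f \<in> W"
    and diff: "\<And>f g. f \<in> V \<Longrightarrow> g \<in> V \<Longrightarrow> T (\<lambda>x. f x - g x) = (\<lambda>z. T f z - T g z)"
    and bound: "\<And>q. q \<in> Q \<Longrightarrow> \<exists>p\<in>P. \<exists>C>0. \<forall>f\<in>V. \<forall>r>0. p f \<le> ereal r \<longrightarrow> q (T f) \<le> ereal (C * r)"
  shows "continuous_map (seminorm_topology V P) (seminorm_topology W Q) T"
proof -
  have topV: "topspace (seminorm_topology V P) = V" and topW: "topspace (seminorm_topology W Q) = W"
    by (rule topspace_seminorm_topology, fact, fact)+
  have open_ball: "openin (seminorm_topology V P) {g \<in> V. p (\<lambda>x. g x - f x) < ereal r}"
    if "p \<in> P" "f \<in> V" "0 < r" for p f r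
    unfolding seminorm_topology_def using that by (intro topology_generated_by_Basis) blast
  let ?S = "{{g \<in> W. q (\<lambda>x. g x - f x) < ereal r} | q f r. q \<in> Q \<and> f \<in> W \<and> 0 < r}"
  have "continuous_map (seminorm_topology V P) (topology_generated_by ?S) T"
  proof (rule continuous_on_generated_topo)
    show "T ` topspace (seminorm_topology V P) \<subseteq> \<Union> ?S"
      using T topW unfolding topV unfolding seminorm_topology_def topology_generated_by_topspace by blast
  next
    fix U assume "U \<in> ?S"
    then obtain q f0 r where U: "U = {g \<in> W. q (\<lambda>x. g x - f0 x) < ereal r}" and
      q: "q \<in> Q" "f0 \<in> W" "0 < r" by blast
    obtain p C where p: "p \<in> P" and C: "0 < C" and
      pq: "\<And>f r. f \<in> V \<Longrightarrow> 0 < r \<Longrightarrow> p f \<le> ereal r \<Longrightarrow> q (T f) \<le> ereal (C * r)"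
      using bound[OF q(1)] by blast
    show "openin (seminorm_topology V P) (T -` U \<inter> topspace (seminorm_topology V P))"
      unfolding topV
    proof (subst openin_subopen, rule ballI)
      fix g assume "g \<in> T -` U \<inter> V"
      then have g: "g \<in> V" "q (\<lambda>x. T g x - f0 x) < ereal r" by (auto simp: U)
      from ereal_dense2[OF g(2)] obtain s where s: "q (\<lambda>x. T g x - f0 x) < ereal s" "s < r" by auto
      \<comment> \<open>The image of the ball moves by at most half of the slack r - s, which leaves
        the distance to \<open>f0\<close> below (r + s) / 2.\<close>
      define \<rho> where "\<rho> = (r - s) / (2 * C)"
      have \<rho>: "0 < \<rho>" using s C by (simp add: \<rho>_def)
      let ?B = "{h \<in> V. p (\<lambda>x. h x - g x) < ereal \<rho>}"
      have "?B \<subseteq> T -` U \<inter> V"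
      proof
        fix h assume "h \<in> ?B"
        then have h: "h \<in> V" "p (\<lambda>x. h x - g x) \<le> ereal \<rho>" by auto
        have "q (\<lambda>x. T h x - T g x) \<le> ereal (C * \<rho>)"
          using pq[OF V[OF h(1) g(1)] \<rho> h(2)] by (simp add: diff h g)
        moreover have "q (\<lambda>x. T h x - f0 x) \<le> q (\<lambda>x. T h x - T g x) + q (\<lambda>x. T g x - f0 x)"
          by (intro triangle q T h g)
        ultimately have "q (\<lambda>x. T h x - f0 x) \<le> ereal (C * \<rho>) + ereal s"
          using s(1) by (meson add_mono less_imp_le order_trans)
        also have "\<dots> = ereal ((r + s) / 2)" using C by (simp add: \<rho>_def field_simps)
        also have "\<dots> < ereal r" using s(2) by simp
        finally show "h \<in> T -` U \<inter> V" using h T by (simp add: U)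
      qed
      moreover have "g \<in> ?B" using g \<rho> P(2)[OF p] by simp
      ultimately show "\<exists>B. openin (seminorm_topology V P) B \<and> g \<in> B \<and> B \<subseteq> T -` U \<inter> V"
        using open_ball[OF p g(1) \<rho>] by blast
    qed
  qed
  then show ?thesis by (simp add: seminorm_topology_def[of W])
qed

section \<open>Log-convex sequences and their weights\<close>

lemma log_convex_ratio_mono:
  assumes pos: "\<And>k. 0 < M k" and "log_convex M" and "i \<le> j"
  shows "M (Suc i) / M i \<le> M (Suc j) / M j"
proof (rule lift_Suc_mono_le[OF _ \<open>i \<le> j\<close>])
  fix n
  have "(M (Suc n))\<^sup>2 \<le> M n * M (Suc (Suc n))"
    using assms(2)[unfolded log_convex_def, rule_format, of "Suc n"] by simp
  then show "M (Suc n) / M n \<le> M (Suc (Suc n)) / M (Suc n)"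
    using pos[of n] pos[of "Suc n"] by (simp add: field_simps power2_eq_square)
qed

text \<open>Each step from l to l + 1 multiplies the right side by a later, hence larger,
  consecutive ratio than the left side.\<close>

lemma log_convex_superadditive:
  assumes pos: "\<And>k. 0 < M k" and conv: "log_convex M" and "M 0 = 1"
  shows "M j * M l \<le> M (j + l)"
proof (induction l)
  case (Suc l)
  have "M j * M (Suc l) = (M j * M l) * (M (Suc l) / M l)" using pos[of l] by simp
  also have "\<dots> \<le> M (j + l) * (M (Suc (j + l)) / M (j + l))"
    using pos less_imp_le[OF pos] Suc log_convex_ratio_mono[OF pos conv, of l "j + l"]
    by (intro mult_mono) auto
  also have "\<dots> = M (j + Suc l)" using pos[of "j + l"] by simp
  finally show ?case .
qed (use assms in simp)

text \<open>Consecutive terms \<open>r ^ m / K m\<close> have quotient r divided by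
  \<open>K (Suc m) / K m\<close>. As these ratios increase and the one at \<open>k\<close> is r, the
  terms rise up to \<open>k\<close> and do not rise afterwards.\<close>

lemma log_convex_peak:
  assumes pos: "\<And>k. 0 < K k" and conv: "log_convex K" and r: "r = K (Suc k) / K k"
  shows "r ^ m / K m \<le> r ^ k / K k"
proof (cases "k \<le> m")
  case True
  then show ?thesis
  proof (induction m rule: dec_induct)
    case (step m)
    have "r ^ Suc m / K (Suc m) = (r ^ m / K m) * (r / (K (Suc m) / K m))"
      using pos[of m] by simp
    also have "\<dots> \<le> r ^ m / K m"
      using log_convex_ratio_mono[OF pos conv step(1)] pos less_imp_le[OF pos]
      by (intro mult_right_le_one_le) (auto simp: r field_simps)
    finally show ?case using step by linarith
  qed simp
next
  case False
  then have "m \<le> k" by simp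
  then show ?thesis
  proof (induction m rule: inc_induct)
    case (step m)
    have r0: "0 < r" using pos by (simp add: r)
    have "r ^ m / K m = (r ^ Suc m / K (Suc m)) * ((K (Suc m) / K m) / r)"
      using pos[of m] pos[of "Suc m"] r0 by simp
    also have "\<dots> \<le> r ^ Suc m / K (Suc m)"
    proof (rule mult_right_le_one_le)
      have "K (Suc m) / K m \<le> r"
        using log_convex_ratio_mono[OF pos conv, of m k] step(2) by (simp add: r)
      then show "(K (Suc m) / K m) / r \<le> 1" by (rule divide_le_eq_1_pos[OF r0, THEN iffD2])
    qed (use r0 less_imp_le[OF pos] in auto)
    finally show ?case using step by linarith
  qed simp
qed

text \<open>\<open>K_growth\<close> says that \<open>K\<close> outgrows every geometric sequence,
  which makes the real supremum in \<open>w\<close> a supremum of a bounded set.\<close>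

locale weight_sequence =
  fixes K :: "nat \<Rightarrow> real"
  assumes K_pos: "0 < K m"
    and K_0: "K 0 = 1"
    and K_growth: "0 < \<eta> \<Longrightarrow> \<exists>C. \<forall>m. 1 \<le> C * \<eta> ^ m * K m"
begin

lemma bdd_above_w: 
  assumes "0 < r"
  shows "bdd_above (range (\<lambda>m. ln (r ^ m / K m)))"
proof -
  obtain C where C: "\<And>m. 1 \<le> C * (1 / r) ^ m * K m" using K_growth[of "1 / r"] assms by auto
  have "ln (r ^ m / K m) \<le> ln C" for m
  proof -
    have "r ^ m / K m \<le> C"
      using C[of m] K_pos[of m] assms by (simp add: field_simps)
    then show ?thesis using assms K_pos[of m] by (simp add: ln_mono)
  qed
  then show ?thesis by (auto intro!: bdd_aboveI[of _ "ln C"])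
qed

text \<open>Together with \<open>exp_w_le\<close> this describes \<open>exp (w K r)\<close> as the
  least upper bound of the terms, and later arguments use only this description. It includes r = 0,
  where the convention \<open>w K 0 = 0\<close> matches the single non-zero term at m = 0.\<close>

lemma term_le_exp_w: 
  assumes "0 \<le> r" shows "r ^ m / K m \<le> exp (w K r)"
proof (cases "r = 0")
  case True
  then show ?thesis by (cases "m = 0") (auto simp: w_def K_0 power_0_left)
next
  case False
  then have r: "0 < r" using assms by simp
  have "ln (r ^ m / K m) \<le> w K r"
    unfolding w_def using r by (auto intro: cSUP_upper[OF _ bdd_above_w])
  then show ?thesis using r K_pos[of m] by (simp add: ln_ge_iff flip: ln_le_cancel_iff)
qed

lemma exp_w_le:
  assumes "0 \<le> r" and B: "\<And>m. r ^ m / K m \<le> B"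
  shows "exp (w K r) \<le> B"
proof (cases "r = 0")
  case True
  then show ?thesis using B[of 0] by (simp add: w_def K_0)
next
  case False
  then have r: "0 < r" using assms by simp
  have "0 < B" using B[of 0] by (simp add: K_0)
  have "w K r \<le> ln B"
    unfolding w_def using r B K_pos \<open>0 < B\<close> by (auto intro!: cSUP_least ln_mono)
  then show ?thesis using \<open>0 < B\<close> by (simp add: ln_ge_iff)
qed

lemma w_mono:
  assumes "0 \<le> r" "r \<le> s" shows "w K r \<le> w K s"
proof -
  have "exp (w K r) \<le> exp (w K s)"
  proof (rule exp_w_le[OF assms(1)])
    fix m
    have "r ^ m / K m \<le> s ^ m / K m"
      using assms K_pos[of m] by (intro divide_right_mono power_mono) auto
    also have "\<dots> \<le> exp (w K s)" using assms by (intro term_le_exp_w) auto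
    finally show "r ^ m / K m \<le> exp (w K s)" .
  qed
  then show ?thesis by simp
qed

text \<open>The product of two terms of the supremum is at most \<open>c\<close> times the term of
  order j + l at \<open>d * r\<close>. Suprema are taken in one index at a time, dividing by the
  other factor.\<close>

lemma exp_w_double:
  assumes sub: "\<And>j l. K (j + l) \<le> c * d ^ (j + l) * (K j * K l)" and r: "0 < r" and d: "0 < d"
  shows "exp (w K r) * exp (w K r) \<le> c * exp (w K (d * r))"
proof -
  have c: "0 \<le> c" using sub[of 0 0] by (simp add: K_0)
  let ?B = "c * exp (w K (d * r))"
  have prod: "(r ^ j / K j) * (r ^ l / K l) \<le> ?B" for j l
  proof -
    have "(r ^ j / K j) * (r ^ l / K l) \<le> c * ((d * r) ^ (j + l) / K (j + l))"
      using sub[of j l] K_pos[of j] K_pos[of l] K_pos[of "j + l"] r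
      by (simp add: field_simps power_add)
    also have "\<dots> \<le> ?B" using c r d by (intro mult_left_mono term_le_exp_w) auto
    finally show ?thesis .
  qed
  have 1: "exp (w K r) \<le> ?B / (r ^ j / K j)" for j
  proof (rule exp_w_le)
    show "r ^ m / K m \<le> ?B / (r ^ j / K j)" for m
      using prod[of m j] r K_pos[of j] by (intro mult_imp_le_div_pos) auto
  qed (use r in auto)
  have "exp (w K r) \<le> ?B / exp (w K r)"
  proof (rule exp_w_le)
    fix j
    show "r ^ j / K j \<le> ?B / exp (w K r)" using 1[of j] r K_pos[of j] by (simp add: field_simps)
  qed (use r in auto)
  then show ?thesis by (simp add: field_simps)
qed

end

lemma fact_add_le: "(fact (j + l) :: real) \<le> 2 ^ (j + l) * (fact j * fact l)"
proof -
  have "(j + l) choose j \<le> 2 ^ (j + l)"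
    using member_le_sum[of j "{..j + l}" "\<lambda>k. (j + l) choose k"] by (simp add: choose_row_sum)
  then have "real ((j + l) choose j) \<le> 2 ^ (j + l)"
    by (metis of_nat_le_iff of_nat_numeral of_nat_power)
  then show ?thesis
    by (simp add: binomial_fact field_simps)
qed

text \<open>A single term of the exponential series at k + 1 trades the power left by iterated
  Cauchy estimates for a factorial.\<close>

lemma Suc_power_le_exp_fact: "real (Suc k) ^ k \<le> exp (real (Suc k)) * fact k"
proof -
  have "(\<lambda>n. real (Suc k) ^ n /\<^sub>R fact n) sums exp (real (Suc k))" by (rule exp_converges)
  then have "(\<Sum>n\<in>{k}. real (Suc k) ^ n /\<^sub>R fact n) \<le> exp (real (Suc k))"
    by (subst sums_unique, assumption) (intro sum_le_suminf, auto simp: sums_iff)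
  then show ?thesis by (simp add: field_simps)
qed

section \<open>Linear combinations and norms\<close>

lemma iter_partial_lincomb:
  assumes "smooth f" "smooth g"
  shows "iter_partial js (\<lambda>x. a * f x + b * g x) = (\<lambda>x. a * iter_partial js f x + b * iter_partial js g x)"
proof (induction js)
  case (Cons i js)
  have "partial_deriv i (\<lambda>x. a * iter_partial js f x + b * iter_partial js g x) x
      = a * partial_deriv i (iter_partial js f) x + b * partial_deriv i (iter_partial js g) x" for x
    unfolding partial_deriv_def[of i "\<lambda>x. a * iter_partial js f x + b * iter_partial js g x"]
  proof (rule vector_derivative_at)
    show "((\<lambda>t. a * iter_partial js f (x + t *\<^sub>R axis i 1) + b * iter_partial js g (x + t *\<^sub>R axis i 1))
      has_vector_derivative a * partial_deriv i (iter_partial js f) x + b * partial_deriv i (iter_partial js g) x) (at 0)"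
      using partial_deriv_along_axis[OF smoothD(2)[OF smooth_iter_partial[OF assms(1)]], of js x i 0]
        partial_deriv_along_axis[OF smoothD(2)[OF smooth_iter_partial[OF assms(2)]], of js x i 0]
      by (auto intro!: has_vector_derivative_add has_vector_derivative_mult_right)
  qed
  then show ?case using Cons by auto
qed simp

lemma smooth_lincomb:
  assumes "smooth f" "smooth g"
  shows "smooth (\<lambda>x. a * f x + b * g x)"
  unfolding smooth_def iter_partial_lincomb[OF assms]
proof (intro allI conjI)
  fix js i x
  show "continuous_on UNIV (\<lambda>x. a * iter_partial js f x + b * iter_partial js g x)"
    by (intro continuous_intros smoothD smooth_iter_partial assms)
  have "(\<lambda>t. iter_partial js f (x + t *\<^sub>R axis i 1)) differentiable (at 0)"
    "(\<lambda>t. iter_partial js g (x + t *\<^sub>R axis i 1)) differentiable (at 0)"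
    by (intro smoothD smooth_iter_partial assms)+
  then show "(\<lambda>t. a * iter_partial js f (x + t *\<^sub>R axis i 1) + b * iter_partial js g (x + t *\<^sub>R axis i 1))
      differentiable (at 0)"
    by (intro derivative_intros)
qed

lemma entire_lincomb:
  assumes "entire F" "entire G"
  shows "entire (\<lambda>z. a * F z + b * G z)"
  unfolding entire_def
proof
  fix z
  obtain F' G' where "(F has_derivative F') (at z)" "\<And>c v. F' (c *s v) = c * F' v"
    "(G has_derivative G') (at z)" "\<And>c v. G' (c *s v) = c * G' v"
    using assms unfolding entire_def by metis
  then show "\<exists>H. ((\<lambda>z. a * F z + b * G z) has_derivative H) (at z) \<and> (\<forall>c v. H (c *s v) = c * H v)"
    by (intro exI[of _ "\<lambda>v. a * F' v + b * G' v"])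
      (auto intro!: has_derivative_add has_derivative_mult_right simp: algebra_simps)
qed

section \<open>Norm bounds as pointwise inequalities\<close>

lemma SUP_ratio_le_iff:
  fixes u v :: "'a \<Rightarrow> real"
  assumes "\<And>x. 0 < v x"
  shows "(SUP x. ereal (u x / v x)) \<le> ereal P \<longleftrightarrow> (\<forall>x. u x \<le> P * v x)"
  using assms by (simp add: SUP_le_iff divide_le_eq)

lemma SUP_ratio_triangle:
  fixes u1 u2 u3 v :: "'a \<Rightarrow> real"
  assumes "\<And>x. 0 < v x" "\<And>x. u1 x \<le> u2 x + u3 x"
  shows "(SUP x. ereal (u1 x / v x)) \<le> (SUP x. ereal (u2 x / v x)) + (SUP x. ereal (u3 x / v x))"
proof (rule SUP_least)
  fix x
  have "ereal (u1 x / v x) \<le> ereal (u2 x / v x) + ereal (u3 x / v x)"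
    using assms(1)[of x] assms(2)[of x] by (simp add: divide_right_mono flip: add_divide_distrib)
  also have "\<dots> \<le> (SUP x. ereal (u2 x / v x)) + (SUP x. ereal (u3 x / v x))"
    by (intro add_mono SUP_upper) auto
  finally show "ereal (u1 x / v x) \<le> \<dots>" .
qed

lemma ereal_SUP_ratio_finite:
  fixes u v :: "'a \<Rightarrow> real"
  assumes "\<And>x. 0 < v x" "\<And>x. 0 \<le> u x" "(SUP x. ereal (u x / v x)) < \<infinity>"
  obtains P where "0 < P" "\<And>x. u x \<le> P * v x"
proof -
  obtain x0 :: 'a where True by blast
  have "0 \<le> ereal (u x0 / v x0)" using assms(1,2)[of x0] by simp
  also have "\<dots> \<le> (SUP x. ereal (u x / v x))" by (intro SUP_upper) auto
  finally obtain r where r: "(SUP x. ereal (u x / v x)) = ereal r" "0 \<le> r"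
    using assms(3) by (cases "SUP x. ereal (u x / v x)") auto
  \<comment> \<open>The supremum may be 0, and a strictly positive constant is wanted.\<close>
  have "(SUP x. ereal (u x / v x)) \<le> ereal (r + 1)" using r by simp
  then show ?thesis using that[of "r + 1"] r(2) SUP_ratio_le_iff[of v u "r + 1"] assms(1) by simp
qed

text \<open>Every \<open>mi_deriv\<close> is the derivative along some list, and for smooth
  \<open>f\<close> every list derivative is the \<open>mi_deriv\<close> of its counts, so
  multi-indices and extended reals both disappear from the estimates.\<close>

lemma p_norm_le_iff:
  fixes f :: "real^'n::finite \<Rightarrow> complex"
  assumes M: "\<And>k. 0 < M k" and "0 < \<epsilon>" and f: "smooth f"
  shows "p_norm M \<phi> m \<epsilon> f \<le> ereal P \<longleftrightarrow>
    (\<forall>is x. norm (iter_partial is f x) \<le> P * (\<epsilon> ^ length is * M (length is) * exp (\<phi> m x)))"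
proof -
  have "p_norm M \<phi> m \<epsilon> f \<le> ereal P \<longleftrightarrow>
    (\<forall>x \<alpha>. norm (mi_deriv \<alpha> f x) \<le> P * (\<epsilon> ^ mi_order \<alpha> * M (mi_order \<alpha>) * exp (\<phi> m x)))"
    unfolding p_norm_def case_prod_unfold using assms
    by (subst SUP_ratio_le_iff) auto
  also have "\<dots> \<longleftrightarrow> (\<forall>is x. norm (iter_partial is f x) \<le> P * (\<epsilon> ^ length is * M (length is) * exp (\<phi> m x)))"
  proof (intro iffI allI)
    fix x and \<alpha> :: "'n \<Rightarrow> nat"
    assume *: "\<forall>is x. norm (iter_partial is f x) \<le> P * (\<epsilon> ^ length is * M (length is) * exp (\<phi> m x))"
    obtain xs where "mi_deriv \<alpha> f = iter_partial xs f" "length xs = mi_order \<alpha>"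
      by (rule mi_deriv_iter_partial)
    then show "norm (mi_deriv \<alpha> f x) \<le> P * (\<epsilon> ^ mi_order \<alpha> * M (mi_order \<alpha>) * exp (\<phi> m x))"
      using * by metis
  qed (metis iter_partial_mi_deriv[OF f])
  finally show ?thesis .
qed

lemma p_norm_triangle:
  assumes M: "\<And>k. 0 < M k" and "0 < \<epsilon>" and f: "smooth f" "smooth g" "smooth h"
  shows "p_norm M \<phi> m \<epsilon> (\<lambda>x. f x - h x) \<le> p_norm M \<phi> m \<epsilon> (\<lambda>x. f x - g x) + p_norm M \<phi> m \<epsilon> (\<lambda>x. g x - h x)"
  unfolding p_norm_def case_prod_unfold
proof (rule SUP_ratio_triangle)
  have diff: "mi_deriv \<alpha> (\<lambda>x. u x - v x) y = mi_deriv \<alpha> u y - mi_deriv \<alpha> v y"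
    if "smooth u" "smooth v" for \<alpha> u v y
    using iter_partial_lincomb[OF that, of _ 1 "-1"] by (simp add: mi_deriv_def)
  show "norm (mi_deriv (snd y) (\<lambda>x. f x - h x) (fst y)) \<le>
      norm (mi_deriv (snd y) (\<lambda>x. f x - g x) (fst y)) + norm (mi_deriv (snd y) (\<lambda>x. g x - h x) (fst y))" for y
    unfolding diff[OF f(1,3)] diff[OF f(1,2)] diff[OF f(2,3)]
    using norm_triangle_ineq[of "mi_deriv (snd y) f (fst y) - mi_deriv (snd y) g (fst y)"
      "mi_deriv (snd y) g (fst y) - mi_deriv (snd y) h (fst y)"] by simp
qed (use assms in auto)

lemma q_norm_le_iff:
  "q_norm K \<phi> m \<epsilon> F \<le> ereal Q \<longleftrightarrow>
    (\<forall>z. norm (F z) \<le> Q * exp (\<phi> m (Re_vec z) + w K (\<epsilon> * norm (Im_vec z))))"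
  unfolding q_norm_def by (rule SUP_ratio_le_iff) simp

lemma q_norm_triangle:
  "q_norm K \<phi> m \<epsilon> (\<lambda>z. F z - H z) \<le> q_norm K \<phi> m \<epsilon> (\<lambda>z. F z - G z) + q_norm K \<phi> m \<epsilon> (\<lambda>z. G z - H z)"
  unfolding q_norm_def
proof (rule SUP_ratio_triangle)
  show "norm (F z - H z) \<le> norm (F z - G z) + norm (G z - H z)" for z
    using norm_triangle_ineq[of "F z - G z" "G z - H z"] by simp
qed simp

lemma complexify_Re_Im: "z = complexify (Re_vec z) + (\<chi> i. \<i> * of_real (Im_vec z $ i))"
  by (simp add: vec_eq_iff complexify_def Re_vec_def Im_vec_def complex_eq)

lemma norm_imaginary_vec: "norm (\<chi> i. \<i> * complex_of_real (y $ i)) = norm y"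
  by (simp add: norm_vec_def norm_mult)

lemma norm_Re_vec_le: "norm (Re_vec z) \<le> norm z"
  unfolding Re_vec_def by (rule norm_le_componentwise_cart) (simp add: abs_Re_le_cmod)

lemma norm_Im_vec_le: "norm (Im_vec z) \<le> norm z"
  unfolding Im_vec_def by (rule norm_le_componentwise_cart) (simp add: abs_Im_le_cmod)

section \<open>Extension and restriction\<close>

locale ultradifferentiable_setting =
  fixes M K :: "nat \<Rightarrow> real" and t1 t2 :: real and \<phi> :: "nat \<Rightarrow> real^'n::finite \<Rightarrow> real"
  assumes M_pos: "\<And>k. 0 < M k"
    and M_0: "M 0 = 1"
    and M_log_convex: "log_convex M"
    and M_fact: "\<And>\<epsilon>. 0 < \<epsilon> \<Longrightarrow> \<exists>a>0. \<forall>k. M k \<le> a * \<epsilon> ^ k * fact k"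
    and K_pos: "\<And>m. 0 < K m"
    and K_0: "K 0 = 1"
    and K_log_convex: "log_convex K"
    and t1: "1 < t1"
    and t2: "1 < t2"
    and K_M: "\<And>m. inverse t1 * inverse (t2 ^ m) * K m \<le> fact m / M m \<and> fact m / M m \<le> t1 * t2 ^ m * K m"
    and phi_cont: "\<And>m. 1 \<le> m \<Longrightarrow> continuous_on UNIV (\<phi> m)"
    and phi_shift: "\<And>m. 1 \<le> m \<Longrightarrow> \<exists>a>1. \<forall>\<delta>>0. \<exists>b>0. \<forall>R>0. \<forall>x \<xi>. norm \<xi> \<le> R \<longrightarrow>
                      \<phi> (m + 1) (x + \<xi>) \<le> \<phi> m x + w K (a * \<delta> * R) + b"
begin

section \<open>Comparison of \<open>M\<close> with \<open>K\<close>\<close>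

lemma K_le: "K m \<le> t1 * t2 ^ m * (fact m / M m)"
  using K_M[of m] t1 t2 M_pos[of m] by (simp add: field_simps)

lemma fact_K_le: "fact m / K m \<le> t1 * t2 ^ m * M m"
  using K_M[of m] K_pos[of m] M_pos[of m] by (simp add: field_simps)

lemma M_fact_le: "M m / fact m \<le> t1 * t2 ^ m / K m"
  using K_le[of m] K_pos[of m] M_pos[of m] by (simp add: field_simps)

text \<open>Up to a geometric factor \<open>K m\<close> is at least \<open>fact m / M m\<close>, and
  \<open>M_fact\<close> lets that quotient outgrow any geometric sequence; using it at
  \<open>\<eta> / t2\<close> absorbs the factor.\<close>

lemma weight_sequence_K: "weight_sequence K"
proof
  fix \<eta> :: real assume \<eta>: "0 < \<eta>"
  obtain a where a: "0 < a" "\<And>k. M k \<le> a * (\<eta> / t2) ^ k * fact k"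
    using M_fact[of "\<eta> / t2"] \<eta> t2 by auto
  have "1 \<le> (a * t1) * \<eta> ^ m * K m" for m
  proof -
    have "fact m \<le> t1 * t2 ^ m * K m * M m"
      using K_M[of m] M_pos[of m] by (simp add: field_simps)
    also have "\<dots> \<le> t1 * t2 ^ m * K m * (a * (\<eta> / t2) ^ m * fact m)"
      using a(2)[of m] t1 t2 K_pos[of m] by (intro mult_left_mono) auto
    also have "\<dots> = ((a * t1) * \<eta> ^ m * K m) * fact m"
      using t2 by (simp add: field_simps)
    finally show ?thesis by simp
  qed
  then show "\<exists>C. \<forall>m. 1 \<le> C * \<eta> ^ m * K m" by blast
qed (use K_pos K_0 in auto)

sublocale weight_sequence K by (rule weight_sequence_K)

text \<open>Log-convexity of \<open>M\<close> bounds \<open>K (j + l)\<close> by \<open>K j * K l\<close> up to a geometric factor, which is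
  what lets two copies of the weight be absorbed into one by dilating its argument.\<close>

lemma K_add_le: "K (j + l) \<le> t1 ^ 3 * (2 * t2\<^sup>2) ^ (j + l) * (K j * K l)"
proof -
  have "K (j + l) \<le> t1 * t2 ^ (j + l) * (fact (j + l) / M (j + l))" by (rule K_le)
  also have "\<dots> \<le> t1 * t2 ^ (j + l) * (2 ^ (j + l) * (fact j * fact l) / (M j * M l))"
    using t1 t2 M_pos fact_add_le[of j l] log_convex_superadditive[OF M_pos M_log_convex M_0, of j l]
    by (intro mult_left_mono frac_le) auto
  also have "\<dots> = t1 * (2 * t2) ^ (j + l) * ((fact j / M j) * (fact l / M l))"
    by (simp add: power_mult_distrib)
  also have "\<dots> \<le> t1 * (2 * t2) ^ (j + l) * ((t1 * t2 ^ j * K j) * (t1 * t2 ^ l * K l))"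
    using t1 t2 K_M[of j] K_M[of l] M_pos less_imp_le[OF K_pos]
    by (intro mult_left_mono mult_mono) (auto intro!: divide_nonneg_pos)
  also have "\<dots> = t1 ^ 3 * (2 * t2\<^sup>2) ^ (j + l) * (K j * K l)"
    by (simp add: power_mult_distrib power_add power3_eq_cube power2_eq_square mult_ac)
  finally show ?thesis .
qed

text \<open>\<delta> and \<open>C\<close> depend on \<open>m\<close> and \<epsilon> only, not on
  \<open>F\<close>, so the same estimate yields both membership in \<open>G_space\<close> and
  continuity of the restriction.\<close>

lemma restriction_bound:
  assumes m: "1 \<le> m" and \<epsilon>: "0 < \<epsilon>"
  obtains \<delta> C where "0 < \<delta>" "0 < C"
    "\<And>F Q js x. entire F \<Longrightarrow> 0 \<le> Q \<Longrightarrow>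
      (\<And>z. norm (F z) \<le> Q * exp (\<phi> (m + 1) (Re_vec z) + w K (\<delta> * norm (Im_vec z)))) \<Longrightarrow>
      norm (iter_partial js (\<lambda>x. F (complexify x)) x)
        \<le> C * Q * (\<epsilon> ^ length js * M (length js) * exp (\<phi> m x))"
proof -
  obtain a where a: "1 < a" and shift: "\<And>\<delta>. 0 < \<delta> \<Longrightarrow> \<exists>b>0. \<forall>R>0. \<forall>x \<xi>. norm \<xi> \<le> R \<longrightarrow>
                      \<phi> (m + 1) (x + \<xi>) \<le> \<phi> m x + w K (a * \<delta> * R) + b"
    using phi_shift[OF m] by blast
  define d where "d = 2 * t2\<^sup>2"
  \<comment> \<open>All geometric losses are collected here: \<open>exp 1\<close> from (k + 1)^k
    against k!, \<open>d\<close> from doubling the weight in \<open>K_add_le\<close>,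
    \<open>a\<close> from the shift condition, \<open>t2\<close> from comparing \<open>K\<close>
    with \<open>M\<close>.\<close>
  define \<delta> where "\<delta> = \<epsilon> / (exp 1 * d * a * t2)"
  have d: "0 < d" using t2 by (simp add: d_def)
  have \<delta>: "0 < \<delta>" using \<epsilon> d a t2 by (simp add: \<delta>_def)
  obtain b where b: "\<And>R x \<xi>. 0 < R \<Longrightarrow> norm \<xi> \<le> R \<Longrightarrow>
      \<phi> (m + 1) (x + \<xi>) \<le> \<phi> m x + w K (a * \<delta> * R) + b"
    using shift[OF \<delta>] by blast
  \<comment> \<open>The losses independent of \<open>k\<close>: \<open>exp b\<close> from the shift,
    \<open>t1 ^ 3\<close> from \<open>K_add_le\<close>, \<open>exp 1\<close> from the shifted
    exponential bound, \<open>t1\<close> from \<open>fact_K_le\<close>.\<close>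
  define C where "C = exp b * t1 ^ 3 * exp 1 * t1"
  have C: "0 < C" using t1 by (simp add: C_def)
  show ?thesis
  proof (rule that[OF \<delta> C])
    fix F :: "complex^'n \<Rightarrow> complex" and Q :: real and js :: "'n list" and x :: "real^'n"
    assume F: "entire F" and Q: "0 \<le> Q"
      and bd: "\<And>z. norm (F z) \<le> Q * exp (\<phi> (m + 1) (Re_vec z) + w K (\<delta> * norm (Im_vec z)))"
    define k where "k = length js"
    \<comment> \<open>The supremum defining \<open>w K r\<close> is attained at \<open>k\<close>, so this radius optimises Cauchy's estimate.\<close>
    define r where "r = K (Suc k) / K k"
    \<comment> \<open>The doubled weight at \<open>a * \<delta> * R\<close> is bounded by the weight
      at \<open>d * (a * \<delta> * R)\<close>, and this argument should be exactly
      \<open>r\<close>.\<close>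
    define R where "R = r / (d * a * \<delta>)"
    \<comment> \<open>\<open>k\<close> successive steps of this size stay within \<open>R\<close>;
      dividing by k + 1 instead of k also covers k = 0.\<close>
    define \<rho> where "\<rho> = R / real (Suc k)"
    have r: "0 < r" using K_pos by (simp add: r_def)
    have R: "0 < R" using r d a \<delta> by (simp add: R_def)
    have \<rho>: "0 < \<rho>" using R by (simp add: \<rho>_def)
    let ?B = "Q * (exp (\<phi> m x) * exp b * (t1 ^ 3 * (r ^ k / K k)))"
    have "norm (iter_cpartial js F (complexify x)) \<le> ?B / \<rho> ^ length js"
    proof (rule iter_cpartial_bound[OF entire_imp_separately_entire[OF F] \<rho>])
      fix z assume "norm (z - complexify x) \<le> real (length js) * \<rho>"
      also have "\<dots> \<le> R" using R by (simp add: \<rho>_def k_def field_simps)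
      finally have z: "norm (z - complexify x) \<le> R" .
      have re: "Re_vec (z - complexify x) = Re_vec z - x" and im: "Im_vec (z - complexify x) = Im_vec z"
        by (simp_all add: vec_eq_iff Re_vec_def Im_vec_def complexify_def)
      have "norm (Re_vec z - x) \<le> R" "norm (Im_vec z) \<le> R"
        using norm_Re_vec_le[of "z - complexify x"] norm_Im_vec_le[of "z - complexify x"] z
        unfolding re im by linarith+
      then have "\<phi> (m + 1) (Re_vec z) \<le> \<phi> m x + w K (a * \<delta> * R) + b"
        and "w K (\<delta> * norm (Im_vec z)) \<le> w K (a * \<delta> * R)"
        using b[OF R, of "Re_vec z - x" x] a \<delta> R
        by (auto intro!: w_mono mult_mono)
      \<comment> \<open>The shift of the real part and the growth in the imaginary part contribute
        one copy of the weight each. The second is enlarged to the argument of the first, so that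
        doubling applies.\<close>
      then have "\<phi> (m + 1) (Re_vec z) + w K (\<delta> * norm (Im_vec z))
          \<le> \<phi> m x + b + (w K (a * \<delta> * R) + w K (a * \<delta> * R))" by simp
      then have "exp (\<phi> (m + 1) (Re_vec z) + w K (\<delta> * norm (Im_vec z)))
          \<le> exp (\<phi> m x) * exp b * (exp (w K (a * \<delta> * R)) * exp (w K (a * \<delta> * R)))"
        by (simp flip: exp_add)
      also have "\<dots> \<le> exp (\<phi> m x) * exp b * (t1 ^ 3 * exp (w K (d * (a * \<delta> * R))))"
        using K_add_le a \<delta> R d unfolding d_def
        by (intro mult_left_mono exp_w_double) auto
      also have "d * (a * \<delta> * R) = r" using d a \<delta> by (simp add: R_def)
      also have "exp (\<phi> m x) * exp b * (t1 ^ 3 * exp (w K r)) \<le> exp (\<phi> m x) * exp b * (t1 ^ 3 * (r ^ k / K k))"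
        using r t1 log_convex_peak[OF K_pos K_log_convex r_def]
        by (intro mult_left_mono exp_w_le) auto
      finally have "exp (\<phi> (m + 1) (Re_vec z) + w K (\<delta> * norm (Im_vec z)))
          \<le> exp (\<phi> m x) * exp b * (t1 ^ 3 * (r ^ k / K k))" .
      from order_trans[OF bd mult_left_mono[OF this Q]] show "norm (F z) \<le> ?B" .
    qed
    also have "?B / \<rho> ^ length js
        = Q * exp (\<phi> m x) * exp b * t1 ^ 3 * (d * a * \<delta>) ^ k * (real (Suc k) ^ k / K k)"
      using r d a \<delta> by (simp add: \<rho>_def R_def k_def[symmetric] power_divide power_mult_distrib field_simps del: of_nat_Suc)
    also have "\<dots> \<le> Q * exp (\<phi> m x) * exp b * t1 ^ 3 * (d * a * \<delta>) ^ k * (exp 1 * exp 1 ^ k * (t1 * t2 ^ k * M k))"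
    proof (rule mult_left_mono)
      have "real (Suc k) ^ k / K k \<le> exp (real (Suc k)) * fact k / K k"
        using Suc_power_le_exp_fact[of k] K_pos[of k] by (intro divide_right_mono) auto
      also have "\<dots> = exp 1 * exp 1 ^ k * (fact k / K k)"
        by (simp add: exp_add exp_of_nat_mult[of k 1, simplified])
      also have "\<dots> \<le> exp 1 * exp 1 ^ k * (t1 * t2 ^ k * M k)"
        by (intro mult_left_mono fact_K_le) auto
      finally show "real (Suc k) ^ k / K k \<le> exp 1 * exp 1 ^ k * (t1 * t2 ^ k * M k)" .
    qed (use Q t1 d a \<delta> in auto)
    also have "\<dots> = C * Q * ((exp 1 * (d * a * \<delta>) * t2) ^ k * M k * exp (\<phi> m x))"
      by (simp add: C_def power_mult_distrib mult_ac)
    also have "exp 1 * (d * a * \<delta>) * t2 = \<epsilon>" using d a t2 by (simp add: \<delta>_def)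
    finally show "norm (iter_partial js (\<lambda>x. F (complexify x)) x)
        \<le> C * Q * (\<epsilon> ^ length js * M (length js) * exp (\<phi> m x))"
      by (simp add: iter_partial_complexify entire_imp_separately_entire F k_def)
  qed
qed

section \<open>The two spaces as complex vector spaces\<close>

lemma G_spaceD:
  assumes "f \<in> G_space M \<phi>"
  shows "smooth f"
    and "\<And>m \<epsilon>. 1 \<le> m \<Longrightarrow> 0 < \<epsilon> \<Longrightarrow> \<exists>P>0. \<forall>is x.
      norm (iter_partial is f x) \<le> P * (\<epsilon> ^ length is * M (length is) * exp (\<phi> m x))"
proof -
  show f: "smooth f"
    using assms zero_less_one[where 'a = real] unfolding G_space_def G_space_step_def by blast
  fix m :: nat and \<epsilon> :: real assume m: "1 \<le> m" and \<epsilon>: "0 < \<epsilon>"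
  have "p_norm M \<phi> m \<epsilon> f < \<infinity>" using assms m \<epsilon> by (auto simp: G_space_def G_space_step_def)
  from this[unfolded p_norm_def case_prod_unfold] obtain P where "0 < P" and
    P: "\<And>y. norm (mi_deriv (snd y) f (fst y)) \<le> P * (\<epsilon> ^ mi_order (snd y) * M (mi_order (snd y)) * exp (\<phi> m (fst y)))"
    using M_pos \<epsilon> by (elim ereal_SUP_ratio_finite[rotated -1]) auto
  have "p_norm M \<phi> m \<epsilon> f \<le> ereal P"
    unfolding p_norm_def case_prod_unfold using P M_pos \<epsilon> by (subst SUP_ratio_le_iff) auto
  then show "\<exists>P>0. \<forall>is x. norm (iter_partial is f x) \<le> P * (\<epsilon> ^ length is * M (length is) * exp (\<phi> m x))"
    using \<open>0 < P\<close> unfolding p_norm_le_iff[of M, OF M_pos \<epsilon> f] by blast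
qed

lemma G_spaceI:
  assumes f: "smooth f" and P: "\<And>m \<epsilon>. 1 \<le> m \<Longrightarrow> 0 < \<epsilon> \<Longrightarrow> \<exists>P. \<forall>is x.
      norm (iter_partial is f x) \<le> P * (\<epsilon> ^ length is * M (length is) * exp (\<phi> m x))"
  shows "f \<in> G_space M \<phi>"
proof -
  have "p_norm M \<phi> m \<epsilon> f < \<infinity>" if m: "1 \<le> m" and \<epsilon>: "0 < \<epsilon>" for m \<epsilon>
  proof -
    obtain P where "p_norm M \<phi> m \<epsilon> f \<le> ereal P"
      using P[OF m \<epsilon>] unfolding p_norm_le_iff[of M, OF M_pos \<epsilon> f, symmetric] by blast
    then show ?thesis by auto
  qed
  then show ?thesis using f by (auto simp: G_space_def G_space_step_def)
qed

lemma G_space_lincomb: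
  assumes f: "f \<in> G_space M \<phi>" and g: "g \<in> G_space M \<phi>"
  shows "(\<lambda>x. a * f x + b * g x) \<in> G_space M \<phi>"
proof (rule G_spaceI)
  note smooth = G_spaceD(1)[OF f] G_spaceD(1)[OF g]
  show "smooth (\<lambda>x. a * f x + b * g x)" by (intro smooth_lincomb smooth)
  fix m :: nat and \<epsilon> :: real assume m: "1 \<le> m" and \<epsilon>: "0 < \<epsilon>"
  let ?W = "\<lambda>is x. \<epsilon> ^ length is * M (length is) * exp (\<phi> m x)"
  obtain P1 P2 where P: "\<And>is x. norm (iter_partial is f x) \<le> P1 * ?W is x"
    "\<And>is x. norm (iter_partial is g x) \<le> P2 * ?W is x"
    using G_spaceD(2)[OF f m \<epsilon>] G_spaceD(2)[OF g m \<epsilon>] by blast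
  have "norm (a * iter_partial is f x + b * iter_partial is g x) \<le> (norm a * P1 + norm b * P2) * ?W is x" for "is" x
  proof -
    have "norm (a * iter_partial is f x + b * iter_partial is g x)
        \<le> norm a * norm (iter_partial is f x) + norm b * norm (iter_partial is g x)"
      by (metis norm_mult norm_triangle_ineq)
    also have "\<dots> \<le> norm a * (P1 * ?W is x) + norm b * (P2 * ?W is x)"
      by (intro add_mono mult_left_mono P) auto
    finally show ?thesis by (simp add: algebra_simps)
  qed
  then show "\<exists>P. \<forall>is x. norm (iter_partial is (\<lambda>x. a * f x + b * g x) x) \<le> P * ?W is x"
    unfolding iter_partial_lincomb[OF smooth] by blast
qed

lemma E_space_lincomb:
  assumes F: "F \<in> E_space K \<phi>" and G: "G \<in> E_space K \<phi>"
  shows "(\<lambda>z. a * F z + b * G z) \<in> E_space K \<phi>"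
  unfolding E_space_def mem_Collect_eq
proof (intro conjI allI impI)
  show "entire (\<lambda>z. a * F z + b * G z)" using F G by (auto simp: E_space_def intro: entire_lincomb)
  fix m :: nat and \<epsilon> :: real assume "1 \<le> m" "0 < \<epsilon>"
  let ?W = "\<lambda>z. exp (\<phi> m (Re_vec z) + w K (\<epsilon> * norm (Im_vec z)))"
  obtain c1 c2 where c: "0 < c1" "0 < c2" "\<And>z. norm (F z) \<le> c1 * ?W z" "\<And>z. norm (G z) \<le> c2 * ?W z"
    using F G \<open>1 \<le> m\<close> \<open>0 < \<epsilon>\<close> unfolding E_space_def by blast
  \<comment> \<open>The added 1 keeps the constant positive when both coefficients vanish.\<close>
  have "norm (a * F z + b * G z) \<le> (norm a * c1 + norm b * c2 + 1) * ?W z" for z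
  proof -
    have "norm (a * F z + b * G z) \<le> norm a * norm (F z) + norm b * norm (G z)"
      by (metis norm_mult norm_triangle_ineq)
    also have "\<dots> \<le> norm a * (c1 * ?W z) + norm b * (c2 * ?W z) + 1 * ?W z"
      by (intro add_mono mult_left_mono c add_increasing2) auto
    finally show ?thesis by (simp add: algebra_simps)
  qed
  moreover have "0 < norm a * c1 + norm b * c2 + 1"
    using c by (intro add_nonneg_pos add_nonneg_nonneg) auto
  ultimately show "\<exists>c>0. \<forall>z. norm (a * F z + b * G z) \<le> c * ?W z" by blast
qed

text \<open>Continuity bounds \<open>\<phi> 1\<close> on a ball, and the factor
  \<open>\<eta> ^ length is\<close> comes from the norm with parameter \<eta>; therefore the
  comparison of \<open>M\<close> with factorials is used at parameter 1 only.\<close>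

lemma G_space_locally_infra_exponential:
  assumes f: "f \<in> G_space M \<phi>" and "0 < R" "0 < \<eta>"
  shows "\<exists>C. \<forall>y. norm y \<le> R \<longrightarrow>
      (\<forall>is. norm (iter_partial is f y) \<le> C * \<eta> ^ length is * fact (length is))"
proof -
  obtain P where P: "0 < P" "\<And>is x. norm (iter_partial is f x) \<le> P * (\<eta> ^ length is * M (length is) * exp (\<phi> 1 x))"
    using G_spaceD(2)[OF f, of 1 \<eta>] \<open>0 < \<eta>\<close> by auto
  obtain a where a: "0 < a" "\<And>k. M k \<le> a * 1 ^ k * fact k" using M_fact[of 1] by auto
  have "compact (\<phi> 1 ` cball 0 R)"
    by (intro compact_continuous_image continuous_on_subset[OF phi_cont]) auto
  then have "bounded (\<phi> 1 ` cball 0 R)" by (rule compact_imp_bounded)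
  then obtain S where "\<forall>u\<in>\<phi> 1 ` cball 0 R. norm u \<le> S" unfolding bounded_iff by blast
  then have S: "\<phi> 1 y \<le> S" if "norm y \<le> R" for y
    using that by (force dest: bspec[of _ _ "\<phi> 1 y"])
  have "norm (iter_partial is f y) \<le> (P * a * exp S) * \<eta> ^ length is * fact (length is)"
    if "norm y \<le> R" for "is" y
  proof -
    have "norm (iter_partial is f y) \<le> P * (\<eta> ^ length is * (a * fact (length is)) * exp S)"
      using a(2)[of "length is"] a(1) P(1) M_pos less_imp_le[OF M_pos] \<open>0 < \<eta>\<close> S[OF that]
      by (intro order_trans[OF P(2)] mult_left_mono mult_mono) auto
    then show ?thesis by (simp add: mult_ac)
  qed
  then show ?thesis by blast
qed

text \<open>The centre 0 is a choice without effect: by \<open>taylor_series_recentre\<close> any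
  real centre gives the same function.\<close>

definition extension :: "(real^'n \<Rightarrow> complex) \<Rightarrow> complex^'n \<Rightarrow> complex" where
  "extension f = taylor_series (\<lambda>is. iter_partial is f 0)"

lemma extension_complexify: "f \<in> G_space M \<phi> \<Longrightarrow> extension f (complexify x) = f x"
  using taylor_series_eq[where f = f and x = 0 and v = x, OF G_spaceD(1) G_space_locally_infra_exponential]
  by (simp add: extension_def)

lemma infra_exponential_G_space:
  assumes "f \<in> G_space M \<phi>" shows "infra_exponential (\<lambda>is. iter_partial is f x)"
  unfolding infra_exponential_def
proof (intro allI impI)
  fix \<eta> :: real assume "0 < \<eta>"
  have "0 < norm x + 1" by (simp add: add_nonneg_pos)
  from G_space_locally_infra_exponential[OF assms this \<open>0 < \<eta>\<close>]
  show "\<exists>C. \<forall>is. norm (iter_partial is f x) \<le> C * \<eta> ^ length is * fact (length is)" by force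
qed

lemma entire_extension: "f \<in> G_space M \<phi> \<Longrightarrow> entire (extension f)"
  unfolding extension_def by (intro entire_taylor_series infra_exponential_G_space)

text \<open>With the series recentred at the real part of \<open>z\<close>, the displacement is
  purely imaginary and has the norm of the imaginary part. Only derivatives at
  \<open>Re_vec z\<close> occur, so the index \<open>m\<close> is preserved.\<close>

lemma extension_bound:
  assumes m: "1 \<le> m" and \<delta>: "0 < \<delta>"
  obtains \<epsilon> where "0 < \<epsilon>"
    "\<And>f P z. f \<in> G_space M \<phi> \<Longrightarrow> 0 \<le> P \<Longrightarrow>
      (\<And>is x. norm (iter_partial is f x) \<le> P * (\<epsilon> ^ length is * M (length is) * exp (\<phi> m x))) \<Longrightarrow>
      norm (extension f z) \<le> 2 * t1 * P * exp (\<phi> m (Re_vec z) + w K (\<delta> * norm (Im_vec z)))"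
proof -
  define n where "n = real CARD('n)"
  have n: "0 < n" by (simp add: n_def)
  \<comment> \<open>\<open>n\<close> compensates the number of index lists, \<open>t2\<close> the
    comparison of \<open>M\<close> with \<open>K\<close>; the 2 leaves a factor (1/2)^k, whose sum
    accounts for the 2 in the final constant.\<close>
  define \<epsilon> where "\<epsilon> = \<delta> / (2 * n * t2)"
  have \<epsilon>: "0 < \<epsilon>" using \<delta> n t2 by (simp add: \<epsilon>_def)
  show ?thesis
  proof (rule that[OF \<epsilon>])
    fix f :: "real^'n \<Rightarrow> complex" and P :: real and z :: "complex^'n"
    assume f: "f \<in> G_space M \<phi>" and P: "0 \<le> P"
      and bd: "\<And>is x. norm (iter_partial is f x) \<le> P * (\<epsilon> ^ length is * M (length is) * exp (\<phi> m x))"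
    let ?x = "Re_vec z" and ?y = "Im_vec z"
    let ?\<zeta> = "\<chi> i. \<i> * complex_of_real (?y $ i)"
    let ?c = "\<lambda>is. iter_partial is f ?x"
    define A where "A = P * exp (\<phi> m ?x) * t1 * exp (w K (\<delta> * norm ?y))"
    have "extension f z = taylor_series ?c ?\<zeta>"
      unfolding extension_def
      by (subst complexify_Re_Im, rule taylor_series_recentre)
        (use f in \<open>auto intro: G_spaceD G_space_locally_infra_exponential\<close>)
    moreover have "norm (hpoly ?c k ?\<zeta>) \<le> A * (1/2) ^ k" for k
    proof -
      have "norm (hpoly ?c k ?\<zeta>) \<le> P * (\<epsilon> ^ k * M k * exp (\<phi> m ?x)) * (n * norm ?\<zeta>) ^ k / fact k"
        unfolding n_def using bd by (intro norm_hpoly) auto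
      also have "\<dots> = P * exp (\<phi> m ?x) * (\<epsilon> * n * norm ?y) ^ k * (M k / fact k)"
        by (simp add: norm_imaginary_vec power_mult_distrib)
      also have "\<dots> \<le> P * exp (\<phi> m ?x) * (\<epsilon> * n * norm ?y) ^ k * (t1 * t2 ^ k / K k)"
        using P \<epsilon> n by (intro mult_left_mono M_fact_le) auto
      also have "\<dots> = P * exp (\<phi> m ?x) * t1 * ((\<epsilon> * n * t2 * norm ?y) ^ k / K k)"
        by (simp add: power_mult_distrib)
      also have "\<epsilon> * n * t2 * norm ?y = (1/2) * (\<delta> * norm ?y)"
        using n t2 by (simp add: \<epsilon>_def)
      also have "P * exp (\<phi> m ?x) * t1 * (((1/2) * (\<delta> * norm ?y)) ^ k / K k)
          = P * exp (\<phi> m ?x) * t1 * ((\<delta> * norm ?y) ^ k / K k) * (1/2) ^ k"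
      proof -
        have "((1/2) * s) ^ k = s ^ k * (1/2) ^ k" for s :: real
          by (simp only: power_mult_distrib mult.commute)
        then show ?thesis by (simp only: times_divide_eq_right times_divide_eq_left mult.assoc)
      qed
      also have "\<dots> \<le> A * (1/2) ^ k"
        unfolding A_def using P t1 \<delta> by (intro mult_right_mono mult_left_mono term_le_exp_w) auto
      finally show ?thesis .
    qed
    then have "norm (taylor_series ?c ?\<zeta>) \<le> (\<Sum>k. A * (1/2) ^ k)"
      unfolding taylor_series_def by (intro norm_suminf_le summable_mult summable_geometric) auto
    moreover have "(\<Sum>k. A * (1/2) ^ k) = A * 2"
      by (subst suminf_mult) (auto simp: suminf_geometric summable_geometric)
    ultimately show "norm (extension f z) \<le> 2 * t1 * P * exp (\<phi> m ?x + w K (\<delta> * norm ?y))"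
      by (simp add: A_def exp_add mult_ac)
  qed
qed

lemma extension_in_E_space:
  assumes f: "f \<in> G_space M \<phi>"
  shows "extension f \<in> E_space K \<phi>"
  unfolding E_space_def mem_Collect_eq
proof (intro conjI allI impI entire_extension f)
  fix m :: nat and \<delta> :: real assume m: "1 \<le> m" and "0 < \<delta>"
  obtain \<epsilon> where \<epsilon>: "0 < \<epsilon>" and bd: "\<And>f P z. f \<in> G_space M \<phi> \<Longrightarrow> 0 \<le> P \<Longrightarrow>
      (\<And>is x. norm (iter_partial is f x) \<le> P * (\<epsilon> ^ length is * M (length is) * exp (\<phi> m x))) \<Longrightarrow>
      norm (extension f z) \<le> 2 * t1 * P * exp (\<phi> m (Re_vec z) + w K (\<delta> * norm (Im_vec z)))"
    using extension_bound[OF m \<open>0 < \<delta>\<close>] by blast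
  obtain P where "0 < P" "\<And>is x. norm (iter_partial is f x) \<le> P * (\<epsilon> ^ length is * M (length is) * exp (\<phi> m x))"
    using G_spaceD(2)[OF f m \<epsilon>] by blast
  then show "\<exists>c>0. \<forall>z. norm (extension f z) \<le> c * exp (\<phi> m (Re_vec z) + w K (\<delta> * norm (Im_vec z)))"
    using bd[OF f, of P] t1 by (intro exI[of _ "2 * t1 * P"]) auto
qed

lemma restriction_in_G_space:
  assumes F: "F \<in> E_space K \<phi>"
  shows "(\<lambda>x. F (complexify x)) \<in> G_space M \<phi>"
proof (rule G_spaceI)
  have ent: "entire F" using F by (simp add: E_space_def)
  show "smooth (\<lambda>x. F (complexify x))"
    by (intro smooth_complexify entire_imp_separately_entire ent)
  fix m :: nat and \<epsilon> :: real assume m: "1 \<le> m" and \<epsilon>: "0 < \<epsilon>"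
  obtain \<delta> C where \<delta>: "0 < \<delta>" and C: "\<And>F Q js x. entire F \<Longrightarrow> 0 \<le> Q \<Longrightarrow>
      (\<And>z. norm (F z) \<le> Q * exp (\<phi> (m + 1) (Re_vec z) + w K (\<delta> * norm (Im_vec z)))) \<Longrightarrow>
      norm (iter_partial js (\<lambda>x. F (complexify x)) x)
        \<le> C * Q * (\<epsilon> ^ length js * M (length js) * exp (\<phi> m x))"
    using restriction_bound[OF m \<epsilon>] by metis
  obtain Q where "0 < Q" "\<And>z. norm (F z) \<le> Q * exp (\<phi> (m + 1) (Re_vec z) + w K (\<delta> * norm (Im_vec z)))"
    using F \<delta> unfolding E_space_def mem_Collect_eq by (meson le_add2)
  then show "\<exists>P. \<forall>is x. norm (iter_partial is (\<lambda>x. F (complexify x)) x)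
      \<le> P * (\<epsilon> ^ length is * M (length is) * exp (\<phi> m x))"
    using C[OF ent, of Q] by (intro exI[of _ "C * Q"]) auto
qed

text \<open>This reduces linearity of \<open>extension\<close>, and its being inverse to
  restriction, to equations on the real subspace.\<close>

lemma entire_eqI:
  assumes "entire F" "entire G" "\<And>x. F (complexify x) = G (complexify x)"
  shows "F = G"
proof
  fix z
  have "F z - G z = 0"
    by (rule separately_entire_eq_0[OF separately_entire_diff[OF assms(1,2)[THEN entire_imp_separately_entire]]])
      (simp add: assms(3))
  then show "F z = G z" by simp
qed

lemma extension_restriction:
  assumes F: "F \<in> E_space K \<phi>"
  shows "extension (\<lambda>x. F (complexify x)) = F"
  using F by (intro entire_eqI entire_extension restriction_in_G_space extension_complexify)
    (auto simp: E_space_def)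

lemma extension_lincomb:
  assumes f: "f \<in> G_space M \<phi>" and g: "g \<in> G_space M \<phi>"
  shows "extension (\<lambda>x. a * f x + b * g x) = (\<lambda>z. a * extension f z + b * extension g z)"
  by (intro entire_eqI entire_extension entire_lincomb G_space_lincomb f g)
    (simp add: extension_complexify G_space_lincomb f g)

section \<open>Continuity in both directions\<close>

lemma G_space_diff: "f \<in> G_space M \<phi> \<Longrightarrow> g \<in> G_space M \<phi> \<Longrightarrow> (\<lambda>x. f x - g x) \<in> G_space M \<phi>"
  using G_space_lincomb[of f g 1 "-1"] by simp

lemma E_space_diff: "F \<in> E_space K \<phi> \<Longrightarrow> G \<in> E_space K \<phi> \<Longrightarrow> (\<lambda>z. F z - G z) \<in> E_space K \<phi>"
  using E_space_lincomb[of F G 1 "-1"] by simp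

lemma continuous_map_extension: "continuous_map (G_top M \<phi>) (E_top K \<phi>) extension"
  unfolding G_top_def E_top_def
proof (rule continuous_map_seminorm_topology)
  show "extension (\<lambda>x. f x - g x) = (\<lambda>z. extension f z - extension g z)"
    if "f \<in> G_space M \<phi>" "g \<in> G_space M \<phi>" for f g
    using extension_lincomb[OF that, of 1 "-1"] by simp
  fix q assume "q \<in> {q_norm K \<phi> m \<epsilon> | m \<epsilon>. 1 \<le> m \<and> 0 < \<epsilon>}"
  then obtain m \<delta> where q: "q = q_norm K \<phi> m \<delta>" and m: "1 \<le> m" and \<delta>: "0 < \<delta>" by blast
  show "q (\<lambda>x. F x - H x) \<le> q (\<lambda>x. F x - G x) + q (\<lambda>x. G x - H x)" for F G H
    unfolding q by (rule q_norm_triangle)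
  obtain \<epsilon> where \<epsilon>: "0 < \<epsilon>" and bd: "\<And>f P z. f \<in> G_space M \<phi> \<Longrightarrow> 0 \<le> P \<Longrightarrow>
      (\<And>is x. norm (iter_partial is f x) \<le> P * (\<epsilon> ^ length is * M (length is) * exp (\<phi> m x))) \<Longrightarrow>
      norm (extension f z) \<le> 2 * t1 * P * exp (\<phi> m (Re_vec z) + w K (\<delta> * norm (Im_vec z)))"
    using extension_bound[OF m \<delta>] by blast
  have "q (extension f) \<le> ereal (2 * t1 * P)"
    if f: "f \<in> G_space M \<phi>" and "0 < P" "p_norm M \<phi> m \<epsilon> f \<le> ereal P" for f P
    using bd[OF f, of P] that(2,3) unfolding q q_norm_le_iff p_norm_le_iff[of M, OF M_pos \<epsilon> G_spaceD(1)[OF f]] by simp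
  then show "\<exists>p\<in>{p_norm M \<phi> m \<epsilon> | m \<epsilon>. 1 \<le> m \<and> 0 < \<epsilon>}. \<exists>C>0. \<forall>f\<in>G_space M \<phi>. \<forall>r>0.
      p f \<le> ereal r \<longrightarrow> q (extension f) \<le> ereal (C * r)"
    using m \<epsilon> t1 by (intro bexI[of _ "p_norm M \<phi> m \<epsilon>"] exI[of _ "2 * t1"]) auto
qed (auto simp: p_norm_zero q_norm_zero intro: G_space_diff extension_in_E_space zero_less_one)

lemma continuous_map_restriction: "continuous_map (E_top K \<phi>) (G_top M \<phi>) (\<lambda>F x. F (complexify x))"
  unfolding G_top_def E_top_def
proof (rule continuous_map_seminorm_topology)
  fix p assume "p \<in> {p_norm M \<phi> m \<epsilon> | m \<epsilon>. 1 \<le> m \<and> 0 < \<epsilon>}"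
  then obtain m \<epsilon> where p: "p = p_norm M \<phi> m \<epsilon>" and m: "1 \<le> m" and \<epsilon>: "0 < \<epsilon>" by blast
  show "p (\<lambda>x. f x - h x) \<le> p (\<lambda>x. f x - g x) + p (\<lambda>x. g x - h x)"
    if "f \<in> G_space M \<phi>" "g \<in> G_space M \<phi>" "h \<in> G_space M \<phi>" for f g h
    unfolding p by (intro p_norm_triangle M_pos \<epsilon> G_spaceD(1) that)
  obtain \<delta> C where \<delta>: "0 < \<delta>" and "0 < C" and C: "\<And>F Q js x. entire F \<Longrightarrow> 0 \<le> Q \<Longrightarrow>
      (\<And>z. norm (F z) \<le> Q * exp (\<phi> (m + 1) (Re_vec z) + w K (\<delta> * norm (Im_vec z)))) \<Longrightarrow>
      norm (iter_partial js (\<lambda>x. F (complexify x)) x)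
        \<le> C * Q * (\<epsilon> ^ length js * M (length js) * exp (\<phi> m x))"
    using restriction_bound[OF m \<epsilon>] by metis
  have "p (\<lambda>x. F (complexify x)) \<le> ereal (C * Q)"
    if F: "F \<in> E_space K \<phi>" and "0 < Q" "q_norm K \<phi> (m + 1) \<delta> F \<le> ereal Q" for F Q
  proof -
    have "entire F" using F by (simp add: E_space_def)
    from C[OF this, of Q] show ?thesis
      using that(2,3) unfolding p q_norm_le_iff
        p_norm_le_iff[of M, OF M_pos \<epsilon> G_spaceD(1)[OF restriction_in_G_space[OF F]]] by simp
  qed
  then show "\<exists>q\<in>{q_norm K \<phi> m \<epsilon> | m \<epsilon>. 1 \<le> m \<and> 0 < \<epsilon>}. \<exists>C>0. \<forall>F\<in>E_space K \<phi>. \<forall>r>0.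
      q F \<le> ereal r \<longrightarrow> p (\<lambda>x. F (complexify x)) \<le> ereal (C * r)"
    \<comment> \<open>The controlling norm has index m + 1 because the shift condition bounds
      \<open>\<phi> (m + 1)\<close> near a point by \<open>\<phi> m\<close> at that point.\<close>
    using \<delta> \<open>0 < C\<close> by (intro bexI[of _ "q_norm K \<phi> (m + 1) \<delta>"] exI[of _ C]) auto
qed (auto simp: p_norm_zero q_norm_zero intro: E_space_diff restriction_in_G_space zero_less_one)

lemma tvs_isomorphic_G_E: "tvs_isomorphic (G_top M \<phi>) (E_top K \<phi>)"
  unfolding tvs_isomorphic_def topspace_G_top
proof (intro exI[of _ extension] conjI ballI allI)
  have "homeomorphic_maps (G_top M \<phi>) (E_top K \<phi>) extension (\<lambda>F x. F (complexify x))"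
    unfolding homeomorphic_maps_def topspace_G_top topspace_E_top
    using continuous_map_extension continuous_map_restriction
    by (auto simp: extension_complexify extension_restriction)
  then show "homeomorphic_map (G_top M \<phi>) (E_top K \<phi>) extension"
    unfolding homeomorphic_map_maps by blast
next
  fix f g assume "f \<in> G_space M \<phi>" "g \<in> G_space M \<phi>"
  then show "extension (\<lambda>x. f x + g x) = (\<lambda>z. extension f z + extension g z)"
    using extension_lincomb[of f g 1 1] by simp
next
  fix c f assume "f \<in> G_space M \<phi>"
  then show "extension (\<lambda>x. c * f x) = (\<lambda>z. c * extension f z)"
    using extension_lincomb[of f f c 0] by simp
qed

end

theorem mainTheorem1:
  fixes M K :: "nat \<Rightarrow> real"
    and t1 t2 :: real
    and \<phi> :: "nat \<Rightarrow> real^'n::finite \<Rightarrow> real"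
  assumes M_pos: "\<And>k. 0 < M k"
    and M_0: "M 0 = 1"
    and M_lim: "filterlim (\<lambda>k. ln (M k) / real k) at_top sequentially"
    and alpha1: "log_convex M"
    and alpha2: "\<And>\<epsilon>. 0 < \<epsilon> \<Longrightarrow> \<exists>a>0. \<forall>k. M k \<le> a * \<epsilon> ^ k * fact k"
    and K_pos: "\<And>m. 0 < K m"
    and K_0: "K 0 = 1"
    and K_log_convex: "log_convex K"
    and t1: "1 < t1"
    and t2: "1 < t2"
    and alpha3: "\<And>m. inverse t1 * inverse (t2 ^ m) * K m \<le> fact m / M m \<and>
                      fact m / M m \<le> t1 * t2 ^ m * K m"
    and phi_cont: "\<And>m. 1 \<le> m \<Longrightarrow> continuous_on UNIV (\<phi> m)"
    and phi1: "\<And>m. 1 \<le> m \<Longrightarrow> filterlim (\<lambda>x. \<phi> m x / norm x) at_top at_infinity"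
    and phi2: "\<And>m. 1 \<le> m \<Longrightarrow> filterlim (\<lambda>x. \<phi> m x - \<phi> (m + 1) x) at_top at_infinity"
    and phi3: "\<And>m. 1 \<le> m \<Longrightarrow> \<exists>a>1. \<forall>\<delta>>0. \<exists>b>0. \<forall>R>0. \<forall>x \<xi>. norm \<xi> \<le> R \<longrightarrow>
                      \<phi> (m + 1) (x + \<xi>) \<le> \<phi> m x + w K (a * \<delta> * R) + b"
  shows "tvs_isomorphic (G_top M \<phi>) (E_top K \<phi>)"
proof -
  interpret ultradifferentiable_setting M K t1 t2 \<phi>
    by unfold_locales (fact M_pos M_0 alpha1 alpha2 K_pos K_0 K_log_convex t1 t2 alpha3 phi_cont phi3)+
  show ?thesis by (rule tvs_isomorphic_G_E)
qed

end
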